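(* For every simple graph $\Gamma$ there exists an integer $n\geq 1$ such that the standard restricted wreath product $nV\wr A_\Gamma\cong\bigl(\bigoplus_{A_\Gamma} nV\bigr)\rtimes A_\Gamma$ embeds isomorphically into $nV$ (i.e. there is an injective group homomorphism $nV\wr A_\Gamma\to nV$).
   Context: A simple graph is a finite (undirected) graph with no loops and no multiple edges. For a simple graph $\Gamma$, the right-angled Artin group $A_\Gamma$ is the group with one generator $g_v$ for each vertex $v$ of $\Gamma$ and one relation $g_vg_w=g_wg_v$ for each pair of vertices $v,w$ connected by an edge. In the restricted wreath product $K\wr G=\bigl(\bigoplus_{G}K\bigr)\rtimes G$, the group $G$ acts on the direct sum of copies of $K$ indexed by $G$ by permuting the copies via the regular action of $G$ on the index set. Brin-Thompson group $nV$: let $X=(\{0,1\}^\omega)^n$, where $\{0,1\}^\omega$ is the space of infinite binary strings with the product topology. For a tuple $(\alpha_1,\dots,\alpha_n)$ of finite (possibly empty) binary strings, the subcube $X(\alpha_1,\dots,\alpha_n)$ is the set of all $(x_1,\dots,x_n)\in X$ such that $x_i$ begins with $\alpha_i$ for each $i$. The canonical homeomorphism between subcubes $X(\alpha_1,\dots,\alpha_n)$ and $X(\beta_1,\dots,\beta_n)$ is the prefix replacement $(\alpha_1\cdot x_1,\dots,\alpha_n\cdot x_n)\mapsto(\beta_1\cdot x_1,\dots,\beta_n\cdot x_n)$, where $\cdot$ is concatenation. A homeomorphism $h\colon X\to X$ belongs to $nV$ if and only if there are two partitions $D_1,\dots,D_k$ and $R_1,\dots,R_k$ of $X$ into the same finite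 number of subcubes such that $h$ maps each $D_i$ to $R_i$ by the canonical homeomorphism. The group operation is composition. *)

theory Defs
  imports
    "Graph_Theory.Pair_Digraph"
    "HOL-Algebra.Bij"
    "HOL-Algebra.Product_Groups"
    "HOL-Analysis.Function_Topology"
    "HOL-Library.Omega_Words_Fun"
begin

section \<open>Groups given by presentations\<close>

text \<open>
  The letter \<open>(s, True)\<close> stands for the generator \<open>s\<close> and \<open>(s, False)\<close> for its formal
  inverse. A relation \<open>u = v\<close> is encoded as the pair \<open>(u, v)\<close> of words.
\<close>

type_synonym 's group_word = "('s \<times> bool) list"

inductive pres_eq ::
  "'s set \<Rightarrow> ('s group_word \<times> 's group_word) set \<Rightarrow> 's group_word \<Rightarrow> 's group_word \<Rightarrow> bool"
  for S R where
  refl: "w \<in> lists (S \<times> UNIV) \<Longrightarrow> pres_eq S R w w"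
| sym: "pres_eq S R u v \<Longrightarrow> pres_eq S R v u"
| trans: "pres_eq S R u v \<Longrightarrow> pres_eq S R v w \<Longrightarrow> pres_eq S R u w"
| append: "pres_eq S R u u' \<Longrightarrow> pres_eq S R v v' \<Longrightarrow> pres_eq S R (u @ v) (u' @ v')"
| cancel: "s \<in> S \<Longrightarrow> pres_eq S R [(s, b), (s, \<not> b)] []"
| relation: "(u, v) \<in> R \<Longrightarrow> u \<in> lists (S \<times> UNIV) \<Longrightarrow> v \<in> lists (S \<times> UNIV) \<Longrightarrow> pres_eq S R u v"

definition pres_rel ::
  "'s set \<Rightarrow> ('s group_word \<times> 's group_word) set \<Rightarrow> 's group_word rel" where
  "pres_rel S R = {(u, v). pres_eq S R u v}"

definition presented_group ::
  "'s set \<Rightarrow> ('s group_word \<times> 's group_word) set \<Rightarrow> 's group_word set monoid" where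
  "presented_group S R =
    \<lparr>carrier = lists (S \<times> UNIV) // pres_rel S R,
     monoid.mult = \<lambda>A B. \<Union>u\<in>A. \<Union>v\<in>B. pres_rel S R `` {u @ v},
     one = pres_rel S R `` {[]}\<rparr>"

text \<open>
  Simple graphs are rendered by the locale \<open>pair_graph\<close> (finite, symmetric, without loops; arcs are
  ordered pairs of vertices, so there are no multiple edges). An edge occurs as two arcs and hence
  contributes its commutation relation in both orientations.
\<close>

definition raag :: "'v pair_pre_digraph \<Rightarrow> 'v group_word set monoid" where
  "raag \<Gamma> = presented_group (pverts \<Gamma>)
    {([(v, True), (w, True)], [(w, True), (v, True)]) | v w. (v, w) \<in> parcs \<Gamma>}"

section \<open>Restricted wreath products\<close>

definition semidirect_product ::
  "('n, 'c) monoid_scheme \<Rightarrow> ('g, 'd) monoid_scheme \<Rightarrow> ('g \<Rightarrow> 'n \<Rightarrow> 'n) \<Rightarrow> ('n \<times> 'g) monoid" where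
  "semidirect_product N G \<phi> =
    \<lparr>carrier = carrier N \<times> carrier G,
     monoid.mult = \<lambda>(a, g) (b, h). (a \<otimes>\<^bsub>N\<^esub> \<phi> g b, g \<otimes>\<^bsub>G\<^esub> h),
     one = (\<one>\<^bsub>N\<^esub>, \<one>\<^bsub>G\<^esub>)\<rparr>"

text \<open>
  Left translation moves the copy of \<open>K\<close> with index \<open>x\<close> to the copy with index \<open>g \<otimes> x\<close>; hence
  the inverse in the argument.
\<close>

definition shift_action :: "('g, 'd) monoid_scheme \<Rightarrow> 'g \<Rightarrow> ('g \<Rightarrow> 'k) \<Rightarrow> 'g \<Rightarrow> 'k" where
  "shift_action G g f = (\<lambda>x\<in>carrier G. f (inv\<^bsub>G\<^esub> g \<otimes>\<^bsub>G\<^esub> x))"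

definition restricted_wreath ::
  "('k, 'c) monoid_scheme \<Rightarrow> ('g, 'd) monoid_scheme \<Rightarrow> (('g \<Rightarrow> 'k) \<times> 'g) monoid" where
  "restricted_wreath K G =
    semidirect_product (sum_group (carrier G) (\<lambda>_. K)) G (shift_action G)"

section \<open>The Brin--Thompson groups\<close>

text \<open>
  A point of the \<open>n\<close>-fold power of the Cantor space is an extensional function on \<open>{..<n}\<close>. Of a
  tuple \<open>\<alpha> :: nat \<Rightarrow> bool list\<close> of finite strings only the entries below \<open>n\<close> matter.
\<close>

definition cantor_cube :: "nat \<Rightarrow> (nat \<Rightarrow> bool word) topology" where
  "cantor_cube n =
    product_topology (\<lambda>_. product_topology (\<lambda>_. discrete_topology UNIV) UNIV) {..<n}"

definition cube_conc :: "nat \<Rightarrow> (nat \<Rightarrow> bool list) \<Rightarrow> (nat \<Rightarrow> bool word) \<Rightarrow> nat \<Rightarrow> bool word" where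
  "cube_conc n \<alpha> x = (\<lambda>i\<in>{..<n}. \<alpha> i \<frown> x i)"

definition subcube :: "nat \<Rightarrow> (nat \<Rightarrow> bool list) \<Rightarrow> (nat \<Rightarrow> bool word) set" where
  "subcube n \<alpha> = {x \<in> topspace (cantor_cube n). \<forall>i<n. \<exists>y. x i = \<alpha> i \<frown> y}"

definition subcube_partition :: "nat \<Rightarrow> nat \<Rightarrow> (nat \<Rightarrow> nat \<Rightarrow> bool list) \<Rightarrow> bool" where
  "subcube_partition n k \<alpha> \<longleftrightarrow>
    disjoint_family_on (\<lambda>j. subcube n (\<alpha> j)) {..<k} \<and>
    (\<Union>j<k. subcube n (\<alpha> j)) = topspace (cantor_cube n)"

definition brin_thompson :: "nat \<Rightarrow> ((nat \<Rightarrow> bool word) \<Rightarrow> nat \<Rightarrow> bool word) monoid" where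
  "brin_thompson n = (BijGroup (topspace (cantor_cube n)))
    \<lparr>carrier := {h \<in> Bij (topspace (cantor_cube n)).
      homeomorphic_map (cantor_cube n) (cantor_cube n) h \<and>
      (\<exists>k \<alpha> \<beta>. subcube_partition n k \<alpha> \<and> subcube_partition n k \<beta> \<and>
        (\<forall>j<k. \<forall>x\<in>topspace (cantor_cube n).
          h (cube_conc n (\<alpha> j) x) = cube_conc n (\<beta> j) x))}\<rparr>"

end

theory Submission
  imports Defs "HOL-Analysis.T1_Spaces"
begin

text \<open>
  Suppose that \<open>A\<^sub>\<Gamma>\<close> acts on the cube \<open>X\<close> by elements of \<open>nV\<close> in such a way that the
  translates of some subcube \<open>D\<close> under distinct group elements are disjoint. Since \<open>D\<close> is a copy
  of \<open>X\<close>, there is a copy of \<open>nV\<close> inside \<open>nV\<close> that moves only points of \<open>D\<close>. Its conjugates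
  under \<open>A\<^sub>\<Gamma>\<close> have disjoint supports and are permuted by \<open>A\<^sub>\<Gamma>\<close> like the translates of \<open>D\<close>,
  so together with \<open>A\<^sub>\<Gamma>\<close> they generate a wreath product (\<open>wreath_embeds\<close>). The action is
  faithful, and a wreath product element that acts trivially must be trivial, because its
  \<open>A\<^sub>\<Gamma>\<close>-part can be read off from the translate to which it takes \<open>D\<close>.

  Such an action comes from a ping-pong argument. Each letter \<open>a\<close> (a generator or an inverse
  generator) gets an attracting subcube \<open>X\<^sub>a\<close> disjoint from \<open>D\<close>, and the generator of a vertex maps
  the complement of its repelling subcube, that is, of the attracting subcube of its inverse, into
  its attracting subcube. Letters of distinct nonadjacent vertices have disjoint subcubes, while the
  letters of adjacent vertices act on disjoint sets of coordinates, hence commute and preserve each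
  other's subcubes. To have room for this, the cube has a coordinate for every ordered
  pair of vertices. A word that is shortest among the words for its group element then maps \<open>D\<close> into the
  subcube of its first letter (\<open>geodesic_into_attractor\<close>), and that subcube is
  disjoint from \<open>D\<close>.

  Membership in \<open>nV\<close> is checked through the criterion \<open>carrier_brin_thompson\<close>: a bijection of
  \<open>X\<close> belongs to \<open>nV\<close> if and only if it is a prefix replacement on all subcubes of sufficiently
  large depth.
\<close>

section \<open>Presented groups and evaluation of words\<close>

lemma pres_eq_in_lists:
  assumes "pres_eq S R u v"
  shows "u \<in> lists (S \<times> UNIV)" "v \<in> lists (S \<times> UNIV)"
proof -
  have "u \<in> lists (S \<times> UNIV) \<and> v \<in> lists (S \<times> UNIV)"
    using assms by (induction rule: pres_eq.induct) auto
  then show "u \<in> lists (S \<times> UNIV)" "v \<in> lists (S \<times> UNIV)" by auto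
qed

lemma equiv_pres_rel: "equiv (lists (S \<times> UNIV)) (pres_rel S R)"
  by (intro equivI refl_onI symI transI)
     (auto simp: pres_rel_def dest: pres_eq_in_lists
       intro: pres_eq.refl pres_eq.sym pres_eq.trans)

lemma pres_class_eq_iff:
  assumes "u \<in> lists (S \<times> UNIV)" "v \<in> lists (S \<times> UNIV)"
  shows "pres_rel S R `` {u} = pres_rel S R `` {v} \<longleftrightarrow> pres_eq S R u v"
  using eq_equiv_class_iff[OF equiv_pres_rel assms, of R] by (simp add: pres_rel_def)

lemma carrier_presented_group:
  "carrier (presented_group S R) = (\<lambda>w. pres_rel S R `` {w}) ` lists (S \<times> UNIV)"
  by (auto simp: presented_group_def quotient_def)

lemma pres_class_in_carrier:
  "w \<in> lists (S \<times> UNIV) \<Longrightarrow> pres_rel S R `` {w} \<in> carrier (presented_group S R)"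
  by (simp only: carrier_presented_group image_eqI)

lemma presented_groupE:
  assumes "x \<in> carrier (presented_group S R)"
  obtains w where "w \<in> lists (S \<times> UNIV)" "x = pres_rel S R `` {w}"
  using assms unfolding carrier_presented_group by blast

lemma one_presented_group: "\<one>\<^bsub>presented_group S R\<^esub> = pres_rel S R `` {[]}"
  by (simp add: presented_group_def)

lemma mult_presented_group:
  assumes "u \<in> lists (S \<times> UNIV)" "v \<in> lists (S \<times> UNIV)"
  shows "pres_rel S R `` {u} \<otimes>\<^bsub>presented_group S R\<^esub> pres_rel S R `` {v}
    = pres_rel S R `` {u @ v}"
proof -
  have "congruent2 (pres_rel S R) (pres_rel S R) (\<lambda>u v. pres_rel S R `` {u @ v})"
  proof (rule congruent2I')
    fix u u' v v' assume "(u, u') \<in> pres_rel S R" "(v, v') \<in> pres_rel S R"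
    then have "(u @ v, u' @ v') \<in> pres_rel S R"
      by (simp add: pres_rel_def pres_eq.append)
    then show "pres_rel S R `` {u @ v} = pres_rel S R `` {u' @ v'}"
      by (rule equiv_class_eq[OF equiv_pres_rel])
  qed
  from UN_equiv_class2[OF equiv_pres_rel equiv_pres_rel this assms] show ?thesis
    by (simp add: presented_group_def)
qed

lemma pres_eq_inverse_word:
  assumes "w \<in> lists (S \<times> UNIV)"
  shows "pres_eq S R (map (apsnd Not) (rev w) @ w) []"
  using assms
proof (induction w)
  case Nil
  then show ?case by (simp add: pres_eq.refl)
next
  case (Cons a w)
  obtain s b where a: "a = (s, b)" by force
  let ?u = "map (apsnd Not) (rev w)"
  have lists: "?u \<in> lists (S \<times> UNIV)" "w \<in> lists (S \<times> UNIV)" "s \<in> S"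
    using Cons.hyps a by fastforce+
  have "pres_eq S R [(s, \<not> b), (s, b)] []"
    using pres_eq.cancel[of s S R "\<not> b"] lists by simp
  then have "pres_eq S R (?u @ ([(s, \<not> b), (s, b)] @ w)) (?u @ ([] @ w))"
    by (intro pres_eq.append pres_eq.refl lists)
  with Cons.IH show ?case
    by (auto simp: a intro: pres_eq.trans)
qed

lemma group_presented_group: "group (presented_group S R)"
proof (rule groupI)
  let ?G = "presented_group S R"
  fix x assume "x \<in> carrier ?G"
  then obtain w where w: "w \<in> lists (S \<times> UNIV)" "x = pres_rel S R `` {w}"
    by (rule presented_groupE)
  let ?v = "map (apsnd Not) (rev w)"
  have v: "?v \<in> lists (S \<times> UNIV)" using w by fastforce
  then have "pres_rel S R `` {?v} \<otimes>\<^bsub>?G\<^esub> x = \<one>\<^bsub>?G\<^esub>"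
    using w pres_eq_inverse_word[OF w(1), of R]
    by (simp add: mult_presented_group one_presented_group pres_class_eq_iff)
  then show "\<exists>y\<in>carrier ?G. y \<otimes>\<^bsub>?G\<^esub> x = \<one>\<^bsub>?G\<^esub>"
    using pres_class_in_carrier[OF v] by blast
qed ((elim presented_groupE)?;
     simp add: mult_presented_group one_presented_group pres_class_in_carrier)+

definition letter_eval :: "('a, 'c) monoid_scheme \<Rightarrow> ('s \<Rightarrow> 'a) \<Rightarrow> 's \<times> bool \<Rightarrow> 'a" where
  "letter_eval H \<phi> a = (if snd a then \<phi> (fst a) else inv\<^bsub>H\<^esub> \<phi> (fst a))"

definition word_eval :: "('a, 'c) monoid_scheme \<Rightarrow> ('s \<Rightarrow> 'a) \<Rightarrow> 's group_word \<Rightarrow> 'a" where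
  "word_eval H \<phi> w = foldr (\<lambda>a h. letter_eval H \<phi> a \<otimes>\<^bsub>H\<^esub> h) w \<one>\<^bsub>H\<^esub>"

lemma word_eval_Nil [simp]: "word_eval H \<phi> [] = \<one>\<^bsub>H\<^esub>"
  and word_eval_Cons [simp]:
    "word_eval H \<phi> (a # w) = letter_eval H \<phi> a \<otimes>\<^bsub>H\<^esub> word_eval H \<phi> w"
  by (simp_all add: word_eval_def)

context group
begin

lemma letter_eval_closed:
  assumes "\<phi> \<in> S \<rightarrow> C" "subgroup C G" "a \<in> S \<times> UNIV"
  shows "letter_eval G \<phi> a \<in> C"
  using assms by (auto simp: letter_eval_def Pi_iff subgroup.m_inv_closed)

lemma word_eval_closed:
  assumes "\<phi> \<in> S \<rightarrow> C" "subgroup C G" "w \<in> lists (S \<times> UNIV)"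
  shows "word_eval G \<phi> w \<in> C"
  using assms(3)
proof (induction w)
  case (Cons a w)
  then show ?case
    using letter_eval_closed[OF assms(1,2)] by (simp add: subgroup.m_closed[OF assms(2)])
qed (simp add: subgroup.one_closed[OF assms(2)])

lemma word_eval_append:
  assumes "\<phi> \<in> S \<rightarrow> carrier G" "u \<in> lists (S \<times> UNIV)" "v \<in> lists (S \<times> UNIV)"
  shows "word_eval G \<phi> (u @ v) = word_eval G \<phi> u \<otimes> word_eval G \<phi> v"
  using assms(2)
proof (induction u)
  case Nil
  then show ?case using word_eval_closed[OF assms(1) subgroup_self assms(3)] by simp
next
  case (Cons a u)
  then show ?case
    using letter_eval_closed[OF assms(1) subgroup_self]
      word_eval_closed[OF assms(1) subgroup_self] assms(3)
    by (simp add: m_assoc)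
qed

lemma word_eval_pres_eq:
  assumes \<phi>: "\<phi> \<in> S \<rightarrow> carrier G"
    and R: "\<And>u v. (u, v) \<in> R \<Longrightarrow> u \<in> lists (S \<times> UNIV) \<Longrightarrow> v \<in> lists (S \<times> UNIV)
      \<Longrightarrow> word_eval G \<phi> u = word_eval G \<phi> v"
    and "pres_eq S R u v"
  shows "word_eval G \<phi> u = word_eval G \<phi> v"
  using assms(3)
proof (induction rule: pres_eq.induct)
  case (append u u' v v')
  then show ?case by (simp add: word_eval_append[OF \<phi>] pres_eq_in_lists)
next
  case (cancel s b)
  then have "\<phi> s \<in> carrier G" using \<phi> by auto
  then show ?case by (simp add: letter_eval_def)
next
  case (relation u v)
  then show ?case by (rule R)
qed simp_all

text \<open>
  Von Dyck's theorem. Words of the same class have the same value, so evaluating an arbitrary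
  representative of a class defines the homomorphism.
\<close>

lemma presented_group_hom:
  assumes \<phi>: "\<phi> \<in> S \<rightarrow> carrier G"
    and R: "\<And>u v. (u, v) \<in> R \<Longrightarrow> u \<in> lists (S \<times> UNIV) \<Longrightarrow> v \<in> lists (S \<times> UNIV)
      \<Longrightarrow> word_eval G \<phi> u = word_eval G \<phi> v"
  obtains \<rho> where "\<rho> \<in> hom (presented_group S R) G"
    and "\<And>w. w \<in> lists (S \<times> UNIV) \<Longrightarrow> \<rho> (pres_rel S R `` {w}) = word_eval G \<phi> w"
proof -
  define \<rho> where "\<rho> A = word_eval G \<phi> (SOME w. w \<in> A)" for A
  have eval: "\<rho> (pres_rel S R `` {w}) = word_eval G \<phi> w" if "w \<in> lists (S \<times> UNIV)" for w
  proof -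
    have "w \<in> pres_rel S R `` {w}" using that by (simp add: pres_rel_def pres_eq.refl)
    then have "(SOME w'. w' \<in> pres_rel S R `` {w}) \<in> pres_rel S R `` {w}" by (rule someI)
    then have "pres_eq S R w (SOME w'. w' \<in> pres_rel S R `` {w})"
      by (simp add: pres_rel_def)
    from word_eval_pres_eq[OF \<phi> R this] show ?thesis by (simp add: \<rho>_def)
  qed
  have "\<rho> \<in> hom (presented_group S R) G"
  proof (rule homI)
    fix A B assume "A \<in> carrier (presented_group S R)" "B \<in> carrier (presented_group S R)"
    then obtain u v where uv: "u \<in> lists (S \<times> UNIV)" "v \<in> lists (S \<times> UNIV)"
      and [simp]: "A = pres_rel S R `` {u}" "B = pres_rel S R `` {v}"
      by (elim presented_groupE)
    show "\<rho> A \<in> carrier G"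
      using uv(1) by (simp add: eval word_eval_closed[OF \<phi> subgroup_self])
    have "u @ v \<in> lists (S \<times> UNIV)" using uv by simp
    from eval[OF this] show "\<rho> (A \<otimes>\<^bsub>presented_group S R\<^esub> B) = \<rho> A \<otimes> \<rho> B"
      using uv by (simp only: \<open>A = _\<close> \<open>B = _\<close> mult_presented_group eval word_eval_append[OF \<phi>])
  qed
  then show ?thesis using eval that by blast
qed

end

section \<open>Wreath products inside permutation groups\<close>

lemma mult_BijGroup_apply:
  assumes "f \<in> Bij X" "g \<in> Bij X" "x \<in> X"
  shows "(f \<otimes>\<^bsub>BijGroup X\<^esub> g) x = f (g x)"
  using assms by (simp add: BijGroup_def compose_def)

lemma mult_BijGroup_closed:
  "f \<in> Bij X \<Longrightarrow> g \<in> Bij X \<Longrightarrow> f \<otimes>\<^bsub>BijGroup X\<^esub> g \<in> Bij X"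
  by (simp add: BijGroup_def compose_Bij)

lemma Bij_apply_closed: "f \<in> Bij X \<Longrightarrow> x \<in> X \<Longrightarrow> f x \<in> X"
  using Bij_imp_funcset by blast

lemma Bij_eqI:
  assumes "f \<in> Bij X" "g \<in> Bij X" "\<And>x. x \<in> X \<Longrightarrow> f x = g x"
  shows "f = g"
  using assms by (meson Bij_imp_extensional extensionalityI)

lemma Bij_eq_iff: "f \<in> Bij X \<Longrightarrow> x \<in> X \<Longrightarrow> y \<in> X \<Longrightarrow> f x = f y \<longleftrightarrow> x = y"
  by (auto simp: Bij_def bij_betw_def inj_on_def)

lemma carrier_BijGroup: "carrier (BijGroup X) = Bij X"
  and one_BijGroup_apply: "x \<in> X \<Longrightarrow> \<one>\<^bsub>BijGroup X\<^esub> x = x"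
  by (simp_all add: BijGroup_def)

lemma BijI:
  assumes "h \<in> extensional X" "\<And>x. x \<in> X \<Longrightarrow> h x \<in> X" "\<And>x. x \<in> X \<Longrightarrow> h' x \<in> X"
    "\<And>x. x \<in> X \<Longrightarrow> h' (h x) = x" "\<And>x. x \<in> X \<Longrightarrow> h (h' x) = x"
  shows "h \<in> Bij X"
  using assms by (auto simp: Bij_def intro!: bij_betw_byWitness[where f' = h'])

text \<open>
  The situation in which a wreath product \<open>K \<wr> G\<close> lives inside a permutation group \<open>C\<close>: a copy
  of \<open>K\<close> in \<open>C\<close> moves only points of \<open>D\<close>, and every nontrivial element of \<open>G\<close> moves \<open>D\<close> off
  itself. Conjugating by the elements of \<open>G\<close> then gives copies of \<open>K\<close> with pairwise disjoint
  supports, so these copies generate their direct sum and \<open>G\<close> permutes them by translation.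
\<close>

locale displaced_support = K: group K + G: group G
  for K :: "('k, 'c) monoid_scheme" and G :: "('g, 'd) monoid_scheme" +
  fixes X D :: "'x set" and C :: "('x \<Rightarrow> 'x) set"
    and \<rho> :: "'g \<Rightarrow> 'x \<Rightarrow> 'x" and \<iota> :: "'k \<Rightarrow> 'x \<Rightarrow> 'x"
  assumes C: "subgroup C (BijGroup X)"
    and \<rho>_hom: "\<rho> \<in> hom G (BijGroup X)" and \<rho>_C: "\<And>g. g \<in> carrier G \<Longrightarrow> \<rho> g \<in> C"
    and \<iota>_mon: "\<iota> \<in> mon K (BijGroup X)" and \<iota>_C: "\<And>k. k \<in> carrier K \<Longrightarrow> \<iota> k \<in> C"
    and D_subset: "D \<subseteq> X" and D_nonempty: "D \<noteq> {}"
    and supported: "\<And>k x. k \<in> carrier K \<Longrightarrow> x \<in> X - D \<Longrightarrow> \<iota> k x = x"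
    and displaced: "\<And>g x. g \<in> carrier G \<Longrightarrow> g \<noteq> \<one>\<^bsub>G\<^esub> \<Longrightarrow> x \<in> D \<Longrightarrow> \<rho> g x \<notin> D"
begin

lemma \<rho>_Bij: "g \<in> carrier G \<Longrightarrow> \<rho> g \<in> Bij X"
  using \<rho>_hom by (auto simp: hom_def carrier_BijGroup)

lemma \<iota>_Bij: "k \<in> carrier K \<Longrightarrow> \<iota> k \<in> Bij X"
  using \<iota>_mon by (auto simp: mon_def hom_def carrier_BijGroup)

lemma \<iota>_hom: "\<iota> \<in> hom K (BijGroup X)"
  using \<iota>_mon by (simp add: mon_def)

lemma \<rho>_closed: "g \<in> carrier G \<Longrightarrow> x \<in> X \<Longrightarrow> \<rho> g x \<in> X"
  by (simp add: \<rho>_Bij Bij_apply_closed)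

lemma \<rho>_mult: "g \<in> carrier G \<Longrightarrow> h \<in> carrier G \<Longrightarrow> x \<in> X \<Longrightarrow> \<rho> (g \<otimes>\<^bsub>G\<^esub> h) x = \<rho> g (\<rho> h x)"
  using \<rho>_hom by (simp add: hom_mult mult_BijGroup_apply \<rho>_Bij)

lemma \<rho>_one: "x \<in> X \<Longrightarrow> \<rho> \<one>\<^bsub>G\<^esub> x = x"
  using hom_one[OF \<rho>_hom G.is_group group_BijGroup] by (simp add: one_BijGroup_apply)

lemma \<rho>_inv [simp]:
  assumes "g \<in> carrier G" "x \<in> X"
  shows "\<rho> (inv\<^bsub>G\<^esub> g) (\<rho> g x) = x" "\<rho> g (\<rho> (inv\<^bsub>G\<^esub> g) x) = x"
  using assms \<rho>_mult[of "inv\<^bsub>G\<^esub> g" g x] \<rho>_mult[of g "inv\<^bsub>G\<^esub> g" x] by (simp_all add: \<rho>_one)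

lemma \<iota>_mult:
  "k \<in> carrier K \<Longrightarrow> l \<in> carrier K \<Longrightarrow> x \<in> X \<Longrightarrow> \<iota> (k \<otimes>\<^bsub>K\<^esub> l) x = \<iota> k (\<iota> l x)"
  using hom_mult[OF \<iota>_hom] by (simp add: mult_BijGroup_apply \<iota>_Bij)

lemma \<iota>_one: "x \<in> X \<Longrightarrow> \<iota> \<one>\<^bsub>K\<^esub> x = x"
  using hom_one[OF \<iota>_hom K.is_group group_BijGroup] by (simp add: one_BijGroup_apply)

lemma \<iota>_preserves:
  assumes "k \<in> carrier K" "x \<in> D"
  shows "\<iota> k x \<in> D"
proof (rule ccontr)
  assume nD: "\<iota> k x \<notin> D"
  have x: "x \<in> X" "\<iota> k x \<in> X"
    using assms D_subset by (auto intro: Bij_apply_closed[OF \<iota>_Bij])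
  then have "\<iota> k (\<iota> k x) = \<iota> k x" using nD assms(1) by (intro supported) auto
  then have "\<iota> k x = x" using Bij_eq_iff[OF \<iota>_Bij] assms x by blast
  then show False using nD assms(2) by simp
qed

lemma translates_disjoint:
  assumes "g \<in> carrier G" "h \<in> carrier G" "x \<in> D" "y \<in> D" "\<rho> g x = \<rho> h y"
  shows "g = h" "x = y"
proof -
  have xy: "x \<in> X" "y \<in> X" using assms D_subset by auto
  have "\<rho> (inv\<^bsub>G\<^esub> h \<otimes>\<^bsub>G\<^esub> g) x = \<rho> (inv\<^bsub>G\<^esub> h) (\<rho> h y)"
    using assms xy by (simp add: \<rho>_mult)
  then have "\<rho> (inv\<^bsub>G\<^esub> h \<otimes>\<^bsub>G\<^esub> g) x \<in> D" using assms xy by simp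
  then have "inv\<^bsub>G\<^esub> h \<otimes>\<^bsub>G\<^esub> g = \<one>\<^bsub>G\<^esub>" using displaced assms by blast
  then show "g = h"
    using assms(1,2) by (metis G.inv_closed G.inv_inv G.inv_equality)
  then show "x = y"
    using assms xy Bij_eq_iff[OF \<rho>_Bij] by blast
qed

text \<open>For \<open>a\<close> in the base group, \<open>spread a\<close> is the commuting product of the elements
  \<open>\<rho> g \<circ> \<iota> (a g) \<circ> \<rho> (inv g)\<close>. Because their supports \<open>\<rho> g ` D\<close> are disjoint, it can be defined
  pointwise, which makes the homomorphism laws immediate.\<close>

definition spread :: "('g \<Rightarrow> 'k) \<Rightarrow> 'x \<Rightarrow> 'x" where
  "spread a = (\<lambda>y\<in>X. if \<exists>g\<in>carrier G. \<exists>x\<in>D. y = \<rho> g x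
     then (let g = SOME g. g \<in> carrier G \<and> (\<exists>x\<in>D. y = \<rho> g x)
           in \<rho> g (\<iota> (a g) (\<rho> (inv\<^bsub>G\<^esub> g) y)))
     else y)"

lemma spread_translate:
  assumes "g \<in> carrier G" "x \<in> D"
  shows "spread a (\<rho> g x) = \<rho> g (\<iota> (a g) x)"
proof -
  have "(SOME h. h \<in> carrier G \<and> (\<exists>z\<in>D. \<rho> g x = \<rho> h z)) = g"
    using assms translates_disjoint(1) by (intro some_equality) auto
  then show ?thesis
    using assms D_subset by (auto simp: spread_def \<rho>_closed subset_iff)
qed

lemma spread_off:
  assumes "y \<in> X" "\<And>g x. g \<in> carrier G \<Longrightarrow> x \<in> D \<Longrightarrow> y \<noteq> \<rho> g x"
  shows "spread a y = y"
  using assms by (auto simp: spread_def)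

abbreviation (input) base :: "('g \<Rightarrow> 'k) set" where
  "base \<equiv> carrier (sum_group (carrier G) (\<lambda>_. K))"

lemma base_iff:
  "a \<in> base \<longleftrightarrow> a \<in> carrier G \<rightarrow>\<^sub>E carrier K \<and> finite {g \<in> carrier G. a g \<noteq> \<one>\<^bsub>K\<^esub>}"
  using carrier_sum_group[of "carrier G" "\<lambda>_. K"] by (simp add: K.is_group)

lemma base_apply: "a \<in> base \<Longrightarrow> g \<in> carrier G \<Longrightarrow> a g \<in> carrier K"
  by (auto simp: base_iff)

lemma translate_cases:
  assumes "y \<in> X"
  obtains (on) g x where "g \<in> carrier G" "x \<in> D" "x \<in> X" "y = \<rho> g x"
    | (off) "\<And>g x. g \<in> carrier G \<Longrightarrow> x \<in> D \<Longrightarrow> y \<noteq> \<rho> g x"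
  using assms D_subset by blast

lemma spread_closed:
  assumes "a \<in> base" "y \<in> X"
  shows "spread a y \<in> X"
  using assms(2)
proof (cases y rule: translate_cases)
  case (on g x)
  then show ?thesis
    using assms by (simp add: spread_translate base_apply \<rho>_closed Bij_apply_closed[OF \<iota>_Bij])
qed (use assms in \<open>simp add: spread_off\<close>)

lemma spread_mult:
  assumes "a \<in> base" "b \<in> base" "y \<in> X"
  shows "spread (a \<otimes>\<^bsub>sum_group (carrier G) (\<lambda>_. K)\<^esub> b) y = spread a (spread b y)"
  using assms(3)
proof (cases y rule: translate_cases)
  case (on g x)
  then show ?thesis
    using assms by (simp add: spread_translate base_apply \<iota>_mult \<iota>_preserves)
qed (use assms in \<open>simp add: spread_off\<close>)

lemma spread_one:
  assumes "y \<in> X"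
  shows "spread \<one>\<^bsub>sum_group (carrier G) (\<lambda>_. K)\<^esub> y = y"
  using assms
proof (cases y rule: translate_cases)
  case (on g x)
  then show ?thesis
    by (simp add: spread_translate \<iota>_one)
qed (use assms in \<open>simp add: spread_off\<close>)

lemma spread_Bij:
  assumes "a \<in> base"
  shows "spread a \<in> Bij X"
proof -
  interpret S: group "sum_group (carrier G) (\<lambda>_. K)" by (simp add: K.is_group)
  let ?b = "inv\<^bsub>sum_group (carrier G) (\<lambda>_. K)\<^esub> a"
  show ?thesis
  proof (rule BijI[where h' = "spread ?b"])
    show "spread a \<in> extensional X" by (simp add: spread_def)
    fix x assume x: "x \<in> X"
    show "spread a x \<in> X" "spread ?b x \<in> X"
      using x assms by (simp_all only: spread_closed S.inv_closed)
    show "spread ?b (spread a x) = x" "spread a (spread ?b x) = x"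
      using x assms spread_one[OF x] spread_mult[of ?b a x] spread_mult[of a ?b x]
      by (simp_all only: S.inv_closed S.l_inv S.r_inv)
  qed
qed

lemma spread_equivariant:
  assumes "a \<in> base" "g \<in> carrier G" "y \<in> X"
  shows "spread (shift_action G g a) (\<rho> g y) = \<rho> g (spread a y)"
  using assms(3)
proof (cases y rule: translate_cases)
  case (on h x)
  have "spread (shift_action G g a) (\<rho> g y)
    = spread (shift_action G g a) (\<rho> (g \<otimes>\<^bsub>G\<^esub> h) x)"
    using on assms by (simp add: \<rho>_mult)
  also have "\<dots> = \<rho> (g \<otimes>\<^bsub>G\<^esub> h) (\<iota> (a h) x)"
    using on assms by (simp add: spread_translate shift_action_def G.m_assoc[symmetric])
  also have "\<dots> = \<rho> g (spread a y)"
    using on assms by (simp add: spread_translate base_apply \<rho>_mult Bij_apply_closed[OF \<iota>_Bij])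
  finally show ?thesis .
next
  case off
  have "\<rho> g y \<noteq> \<rho> h x" if hx: "h \<in> carrier G" "x \<in> D" for h x
  proof
    assume "\<rho> g y = \<rho> h x"
    then have "y = \<rho> (inv\<^bsub>G\<^esub> g) (\<rho> h x)" using assms \<rho>_inv(1)[of g y] by simp
    also have "\<dots> = \<rho> (inv\<^bsub>G\<^esub> g \<otimes>\<^bsub>G\<^esub> h) x" using assms hx D_subset by (auto simp: \<rho>_mult)
    finally show False using off hx assms by blast
  qed
  then have "spread (shift_action G g a) (\<rho> g y) = \<rho> g y"
    using assms by (intro spread_off \<rho>_closed) auto
  then show ?thesis using off assms by (simp add: spread_off)
qed

lemma base_update:
  assumes "a \<in> base" "g \<in> carrier G" "k \<in> carrier K"
  shows "a(g := k) \<in> base"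
proof -
  have "{h \<in> carrier G. (a(g := k)) h \<noteq> \<one>\<^bsub>K\<^esub>} \<subseteq> insert g {h \<in> carrier G. a h \<noteq> \<one>\<^bsub>K\<^esub>}"
    by auto
  then have "finite {h \<in> carrier G. (a(g := k)) h \<noteq> \<one>\<^bsub>K\<^esub>}"
    using assms(1) finite_subset unfolding base_iff by blast
  then show ?thesis
    using assms by (auto simp: base_iff PiE_iff extensional_def)
qed

text \<open>Finiteness of the support enters only here: peeling off one coordinate at a time writes
  \<open>spread a\<close> as a finite product of conjugates of elements of the image of \<open>\<iota>\<close>.\<close>

lemma spread_in_C:
  assumes "a \<in> base"
  shows "spread a \<in> C"
proof -
  interpret B: group "BijGroup X" by (rule group_BijGroup)
  have "spread a \<in> C" if "finite F" "a \<in> base" "{g \<in> carrier G. a g \<noteq> \<one>\<^bsub>K\<^esub>} \<subseteq> F" for F a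
    using that
  proof (induction F arbitrary: a rule: finite_induct)
    case empty
    then have "a = \<one>\<^bsub>sum_group (carrier G) (\<lambda>_. K)\<^esub>"
      by (auto simp: base_iff PiE_iff extensional_def)
    then have "spread a y = y" if "y \<in> X" for y
      using spread_one[OF that] by (simp only:)
    then have "spread a = \<one>\<^bsub>BijGroup X\<^esub>"
      using spread_Bij[OF empty(1)] B.one_closed
      by (intro Bij_eqI[of _ X]) (simp_all add: one_BijGroup_apply carrier_BijGroup)
    then show ?case using subgroup.one_closed[OF C] by simp
  next
    case (insert g F)
    show ?case
    proof (cases "g \<in> carrier G")
      case False
      then show ?thesis using insert by (intro insert.IH) auto
    next
      case g: True
      let ?b = "a(g := \<one>\<^bsub>K\<^esub>)"
      let ?c = "\<rho> g \<otimes>\<^bsub>BijGroup X\<^esub> \<iota> (a g) \<otimes>\<^bsub>BijGroup X\<^esub> \<rho> (inv\<^bsub>G\<^esub> g)"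
      have ag: "a g \<in> carrier K" using insert.prems g by (auto simp: base_apply)
      have b: "?b \<in> base" using insert.prems g by (auto intro: base_update)
      have "{h \<in> carrier G. ?b h \<noteq> \<one>\<^bsub>K\<^esub>} \<subseteq> F" using insert.prems by auto
      then have bC: "spread ?b \<in> C" by (rule insert.IH[OF b])
      have cC: "?c \<in> C"
        using g ag by (intro subgroup.m_closed[OF C] \<rho>_C \<iota>_C) auto
      have "spread a = ?c \<otimes>\<^bsub>BijGroup X\<^esub> spread ?b"
      proof (rule Bij_eqI)
        show "spread a \<in> Bij X" by (rule spread_Bij) fact
        show "?c \<otimes>\<^bsub>BijGroup X\<^esub> spread ?b \<in> Bij X"
          using subgroup.m_closed[OF C cC bC] subgroup.subset[OF C] by (auto simp: carrier_BijGroup)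
        fix y assume y: "y \<in> X"
        have c: "?c z = \<rho> g (\<iota> (a g) (\<rho> (inv\<^bsub>G\<^esub> g) z))" if "z \<in> X" for z
          using that g ag by (simp add: mult_BijGroup_apply \<rho>_Bij \<iota>_Bij \<rho>_closed
              mult_BijGroup_closed)
        have cb: "(?c \<otimes>\<^bsub>BijGroup X\<^esub> spread ?b) y = ?c (spread ?b y)"
          using y b cC subgroup.subset[OF C]
          by (intro mult_BijGroup_apply spread_Bij) (auto simp: carrier_BijGroup)
        have c_id: "?c z = z" if "z \<in> X" "\<And>x. x \<in> D \<Longrightarrow> z \<noteq> \<rho> g x" for z
        proof -
          have "\<rho> (inv\<^bsub>G\<^esub> g) z \<notin> D" using that g by force
          then have "\<iota> (a g) (\<rho> (inv\<^bsub>G\<^esub> g) z) = \<rho> (inv\<^bsub>G\<^esub> g) z"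
            using that g ag by (intro supported) (auto simp: \<rho>_closed)
          then show ?thesis using that g by (simp add: c)
        qed
        show "spread a y = (?c \<otimes>\<^bsub>BijGroup X\<^esub> spread ?b) y"
          using y
        proof (cases y rule: translate_cases)
          case (on h x)
          show ?thesis
          proof (cases "h = g")
            case True
            then show ?thesis
              using on g unfolding cb by (simp add: spread_translate c \<iota>_one \<rho>_closed)
          next
            case False
            have ah: "a h \<in> carrier K" using insert.prems on by (auto simp: base_apply)
            have eq: "spread ?b y = \<rho> h (\<iota> (a h) x)" using on False by (simp add: spread_translate)
            have "?c (\<rho> h (\<iota> (a h) x)) = \<rho> h (\<iota> (a h) x)"
              using on ah g False translates_disjoint(1)[of h g "\<iota> (a h) x"]
              by (intro c_id \<rho>_closed) (auto simp: \<iota>_preserves Bij_apply_closed[OF \<iota>_Bij])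
            then show ?thesis unfolding cb eq using on by (simp add: spread_translate)
          qed
        next
          case off
          then show ?thesis unfolding cb using y g by (simp add: spread_off c_id)
        qed
      qed
      then show ?thesis using subgroup.m_closed[OF C cC bC] by simp
    qed
  qed
  then show ?thesis using assms by (auto simp: base_iff)
qed

lemma spread_inj:
  assumes "a \<in> base" "b \<in> base" "\<And>y. y \<in> X \<Longrightarrow> spread a y = spread b y"
  shows "a = b"
proof (rule extensionalityI[where A = "carrier G"])
  show "a \<in> extensional (carrier G)" "b \<in> extensional (carrier G)"
    using assms by (auto simp: base_iff PiE_iff)
  fix g assume g: "g \<in> carrier G"
  have ab: "a g \<in> carrier K" "b g \<in> carrier K" using g assms by (auto simp: base_apply)
  have "\<iota> (a g) x = \<iota> (b g) x" if "x \<in> X" for x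
  proof (cases "x \<in> D")
    case True
    then have "\<rho> g (\<iota> (a g) x) = \<rho> g (\<iota> (b g) x)"
      using assms(3)[of "\<rho> g x"] g that by (simp add: spread_translate \<rho>_closed)
    then show ?thesis
      using Bij_eq_iff[OF \<rho>_Bij] g ab that Bij_apply_closed[OF \<iota>_Bij] by blast
  next
    case False
    then show ?thesis using that ab by (simp add: supported)
  qed
  then have "\<iota> (a g) = \<iota> (b g)" using ab by (intro Bij_eqI[of _ X]) (auto simp: \<iota>_Bij)
  then show "a g = b g" using \<iota>_mon ab by (auto simp: mon_def inj_on_def)
qed

lemma shift_base:
  assumes "a \<in> base" "g \<in> carrier G"
  shows "shift_action G g a \<in> base"
proof -
  have "{h \<in> carrier G. shift_action G g a h \<noteq> \<one>\<^bsub>K\<^esub>}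
      \<subseteq> (\<lambda>h. g \<otimes>\<^bsub>G\<^esub> h) ` {h \<in> carrier G. a h \<noteq> \<one>\<^bsub>K\<^esub>}"
  proof
    fix h assume "h \<in> {h \<in> carrier G. shift_action G g a h \<noteq> \<one>\<^bsub>K\<^esub>}"
    then show "h \<in> (\<lambda>h. g \<otimes>\<^bsub>G\<^esub> h) ` {h \<in> carrier G. a h \<noteq> \<one>\<^bsub>K\<^esub>}"
      using assms(2) by (intro image_eqI[of _ _ "inv\<^bsub>G\<^esub> g \<otimes>\<^bsub>G\<^esub> h"])
        (auto simp: shift_action_def G.m_assoc[symmetric])
  qed
  then have "finite {h \<in> carrier G. shift_action G g a h \<noteq> \<one>\<^bsub>K\<^esub>}"
    using assms(1) unfolding base_iff by (blast intro: finite_subset)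
  then show ?thesis
    using assms by (auto simp: base_iff shift_action_def)
qed

theorem wreath_embeds:
  "(\<lambda>(a, g). spread a \<otimes>\<^bsub>BijGroup X\<^esub> \<rho> g)
    \<in> mon (restricted_wreath K G) (BijGroup X\<lparr>carrier := C\<rparr>)"
proof -
  interpret B: group "BijGroup X" by (rule group_BijGroup)
  let ?W = "restricted_wreath K G"
  let ?F = "\<lambda>(a, g). spread a \<otimes>\<^bsub>BijGroup X\<^esub> \<rho> g"
  have carrier: "carrier ?W = base \<times> carrier G"
    by (simp add: restricted_wreath_def semidirect_product_def)
  have F_C: "spread a \<otimes>\<^bsub>BijGroup X\<^esub> \<rho> g \<in> C" if "a \<in> base" "g \<in> carrier G" for a g
    using that by (intro subgroup.m_closed[OF C] spread_in_C \<rho>_C)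
  have F_Bij: "spread a \<otimes>\<^bsub>BijGroup X\<^esub> \<rho> g \<in> Bij X" if "a \<in> base" "g \<in> carrier G" for a g
    using F_C[OF that] subgroup.subset[OF C] by (auto simp: carrier_BijGroup)
  have F_apply: "(spread a \<otimes>\<^bsub>BijGroup X\<^esub> \<rho> g) x = spread a (\<rho> g x)"
    if "a \<in> base" "g \<in> carrier G" "x \<in> X" for a g x
    using that by (intro mult_BijGroup_apply spread_Bij \<rho>_Bij)
  show ?thesis
    unfolding mon_def
  proof (intro CollectI conjI homI inj_onI)
    fix p assume "p \<in> carrier ?W"
    then show "?F p \<in> carrier (BijGroup X\<lparr>carrier := C\<rparr>)" by (auto simp: carrier F_C)
  next
    fix p q assume "p \<in> carrier ?W" "q \<in> carrier ?W"
    then obtain a g b h where [simp]: "p = (a, g)" "q = (b, h)"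
      and a: "a \<in> base" and g: "g \<in> carrier G" and b: "b \<in> base" and h: "h \<in> carrier G"
      by (auto simp: carrier)
    interpret S: group "sum_group (carrier G) (\<lambda>_. K)" by (simp add: K.is_group)
    let ?c = "a \<otimes>\<^bsub>sum_group (carrier G) (\<lambda>_. K)\<^esub> shift_action G g b"
    have c: "?c \<in> base" using a b g by (intro S.m_closed shift_base)
    have gh: "g \<otimes>\<^bsub>G\<^esub> h \<in> carrier G" using g h by simp
    have "spread ?c \<otimes>\<^bsub>BijGroup X\<^esub> \<rho> (g \<otimes>\<^bsub>G\<^esub> h)
        = (spread a \<otimes>\<^bsub>BijGroup X\<^esub> \<rho> g) \<otimes>\<^bsub>BijGroup X\<^esub> (spread b \<otimes>\<^bsub>BijGroup X\<^esub> \<rho> h)"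
    proof (rule Bij_eqI)
      show "spread ?c \<otimes>\<^bsub>BijGroup X\<^esub> \<rho> (g \<otimes>\<^bsub>G\<^esub> h) \<in> Bij X" by (rule F_Bij[OF c gh])
      show "(spread a \<otimes>\<^bsub>BijGroup X\<^esub> \<rho> g) \<otimes>\<^bsub>BijGroup X\<^esub> (spread b \<otimes>\<^bsub>BijGroup X\<^esub> \<rho> h) \<in> Bij X"
        using F_Bij[OF a g] F_Bij[OF b h] by (rule mult_BijGroup_closed)
      fix x assume x: "x \<in> X"
      have "(spread ?c \<otimes>\<^bsub>BijGroup X\<^esub> \<rho> (g \<otimes>\<^bsub>G\<^esub> h)) x
          = spread a (spread (shift_action G g b) (\<rho> g (\<rho> h x)))"
        using F_apply[OF c gh x] spread_mult[OF a shift_base[OF b g] \<rho>_closed[OF gh x]]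
        by (simp only: \<rho>_mult[OF g h x])
      also have "\<dots> = spread a (\<rho> g (spread b (\<rho> h x)))"
        using spread_equivariant[OF b g \<rho>_closed[OF h x]] by simp
      also have "\<dots> = ((spread a \<otimes>\<^bsub>BijGroup X\<^esub> \<rho> g) \<otimes>\<^bsub>BijGroup X\<^esub> (spread b \<otimes>\<^bsub>BijGroup X\<^esub> \<rho> h)) x"
        using mult_BijGroup_apply[OF F_Bij[OF a g] F_Bij[OF b h] x] F_apply[OF b h x]
          F_apply[OF a g spread_closed[OF b \<rho>_closed[OF h x]]] by simp
      finally show "(spread ?c \<otimes>\<^bsub>BijGroup X\<^esub> \<rho> (g \<otimes>\<^bsub>G\<^esub> h)) x
        = ((spread a \<otimes>\<^bsub>BijGroup X\<^esub> \<rho> g) \<otimes>\<^bsub>BijGroup X\<^esub> (spread b \<otimes>\<^bsub>BijGroup X\<^esub> \<rho> h)) x" .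
    qed
    then show "?F (p \<otimes>\<^bsub>?W\<^esub> q) = ?F p \<otimes>\<^bsub>BijGroup X\<lparr>carrier := C\<rparr>\<^esub> ?F q"
      by (simp add: restricted_wreath_def semidirect_product_def del: mult_sum_group)
  next
    fix p q assume "p \<in> carrier ?W" "q \<in> carrier ?W" and eq: "?F p = ?F q"
    then obtain a g b h where [simp]: "p = (a, g)" "q = (b, h)"
      and a: "a \<in> base" and g: "g \<in> carrier G" and b: "b \<in> base" and h: "h \<in> carrier G"
      by (auto simp: carrier)
    have F_eq: "spread a (\<rho> g x) = spread b (\<rho> h x)" if "x \<in> X" for x
      using fun_cong[OF eq, of x] that a b g h by (simp add: F_apply)
    \<comment> \<open>The images of a point of \<open>D\<close> lie in the translates by \<open>g\<close> and by \<open>h\<close>.\<close>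
    obtain x where x: "x \<in> D" using D_nonempty by blast
    have "\<rho> g (\<iota> (a g) x) = \<rho> h (\<iota> (b h) x)"
      using F_eq[of x] x g h D_subset by (auto simp: spread_translate)
    then have gh: "g = h"
      using g h a b x by (intro translates_disjoint(1)) (auto simp: \<iota>_preserves base_apply)
    have "spread a y = spread b y" if "y \<in> X" for y
      using F_eq[of "\<rho> (inv\<^bsub>G\<^esub> g) y"] that g gh by (simp add: \<rho>_closed)
    then show "p = q" using gh spread_inj[OF a b] by simp
  qed
qed

end

section \<open>Ping-pong for right-angled Artin groups\<close>

abbreviation raag_relations :: "'v pair_pre_digraph \<Rightarrow> ('v group_word \<times> 'v group_word) set" where
  "raag_relations \<Gamma> \<equiv> {([(v, True), (w, True)], [(w, True), (v, True)]) | v w. (v, w) \<in> parcs \<Gamma>}"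

lemma (in group) inv_commute:
  assumes "x \<in> carrier G" "y \<in> carrier G" "x \<otimes> y = y \<otimes> x"
  shows "inv x \<otimes> y = y \<otimes> inv x"
proof -
  have "inv x \<otimes> y = inv x \<otimes> (y \<otimes> x) \<otimes> inv x" using assms(1,2) by (simp add: m_assoc)
  also have "\<dots> = inv x \<otimes> (x \<otimes> y) \<otimes> inv x" using assms(3) by simp
  also have "\<dots> = y \<otimes> inv x" using assms(1,2) by (simp add: m_assoc[symmetric])
  finally show ?thesis .
qed

text \<open>
  The defining relations speak of positive letters only. For the other signs the argument passes to
  the presented group, where an element that commutes with \<open>x\<close> commutes with the inverse of \<open>x\<close>.
\<close>

lemma raag_letters_commute:
  fixes \<Gamma> :: "'v pair_pre_digraph"
  assumes "pair_graph \<Gamma>" "(v, w) \<in> parcs \<Gamma>"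
  shows "pres_eq (pverts \<Gamma>) (raag_relations \<Gamma>) [(v, b), (w, c)] [(w, c), (v, b)]"
proof -
  interpret pair_graph \<Gamma> by fact
  let ?S = "pverts \<Gamma>" and ?R = "raag_relations \<Gamma>"
  let ?G = "presented_group ?S ?R"
  let ?cl = "\<lambda>w. pres_rel ?S ?R `` {w}"
  interpret G: group ?G by (rule group_presented_group)
  have vw: "v \<in> ?S" "w \<in> ?S" using assms(2) by (auto dest: in_arcsD1 in_arcsD2)
  have cl_mult: "?cl [x] \<otimes>\<^bsub>?G\<^esub> ?cl [y] = ?cl [x, y]" if "fst x \<in> ?S" "fst y \<in> ?S" for x y
    using that mult_presented_group[of "[x]" ?S "[y]" ?R] by (simp add: mem_Times_iff)
  have inv: "?cl [(u, False)] = inv\<^bsub>?G\<^esub> ?cl [(u, True)]" if "u \<in> ?S" for u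
  proof (rule G.inv_equality[symmetric])
    show "?cl [(u, False)] \<otimes>\<^bsub>?G\<^esub> ?cl [(u, True)] = \<one>\<^bsub>?G\<^esub>"
      using that pres_eq.cancel[of u ?S ?R False]
      by (simp add: cl_mult one_presented_group pres_class_eq_iff)
  qed (use that in \<open>simp_all add: pres_class_in_carrier\<close>)
  have mem: "?cl [(u, d)] \<in> carrier ?G" if "u \<in> ?S" for u d
    using that by (simp add: pres_class_in_carrier)
  have "pres_eq ?S ?R [(v, True), (w, True)] [(w, True), (v, True)]"
    using vw assms(2) by (intro pres_eq.relation) auto
  then have "?cl [(v, True)] \<otimes>\<^bsub>?G\<^esub> ?cl [(w, True)] = ?cl [(w, True)] \<otimes>\<^bsub>?G\<^esub> ?cl [(v, True)]"
    using vw by (simp add: cl_mult pres_class_eq_iff)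
  then have "?cl [(v, b)] \<otimes>\<^bsub>?G\<^esub> ?cl [(w, True)] = ?cl [(w, True)] \<otimes>\<^bsub>?G\<^esub> ?cl [(v, b)]"
    using vw by (cases b) (simp_all add: inv mem G.inv_commute)
  then have "?cl [(v, b)] \<otimes>\<^bsub>?G\<^esub> ?cl [(w, c)] = ?cl [(w, c)] \<otimes>\<^bsub>?G\<^esub> ?cl [(v, b)]"
    using vw G.inv_commute[of "?cl [(w, True)]" "?cl [(v, b)]"]
    by (cases c) (simp_all add: inv[of w] mem)
  then show ?thesis using vw by (simp add: cl_mult pres_class_eq_iff)
qed

text \<open>
  In a shortest representative, no letter and its inverse can be brought together and cancelled.
\<close>

definition geodesic :: "'s set \<Rightarrow> ('s group_word \<times> 's group_word) set \<Rightarrow> 's group_word \<Rightarrow> bool" where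
  "geodesic S R w \<longleftrightarrow> w \<in> lists (S \<times> UNIV) \<and> (\<forall>w'. pres_eq S R w w' \<longrightarrow> length w \<le> length w')"

lemma geodesic_tl:
  assumes "geodesic S R (a # w)"
  shows "geodesic S R w"
  unfolding geodesic_def
proof (intro conjI allI impI)
  have a: "[a] \<in> lists (S \<times> UNIV)" and w: "w \<in> lists (S \<times> UNIV)"
    using assms by (auto simp: geodesic_def)
  show "w \<in> lists (S \<times> UNIV)" by (rule w)
  fix w' assume "pres_eq S R w w'"
  then have "pres_eq S R ([a] @ w) ([a] @ w')" by (intro pres_eq.append pres_eq.refl a)
  then show "length w \<le> length w'" using assms by (auto simp: geodesic_def)
qed

lemma geodesic_exists:
  assumes "w \<in> lists (S \<times> UNIV)"
  obtains w' where "geodesic S R w'" "pres_eq S R w w'"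
proof -
  define w' where "w' = arg_min length (pres_eq S R w)"
  have w': "pres_eq S R w w'"
    unfolding w'_def by (rule arg_min_natI) (rule pres_eq.refl[OF assms])
  moreover have "geodesic S R w'"
    unfolding geodesic_def
  proof (intro conjI allI impI)
    show "w' \<in> lists (S \<times> UNIV)" using w' by (rule pres_eq_in_lists)
    fix u assume "pres_eq S R w' u"
    then have "pres_eq S R w u" using w' by (blast intro: pres_eq.trans)
    then show "length w' \<le> length u" unfolding w'_def by (rule arg_min_nat_le)
  qed
  ultimately show ?thesis using that by blast
qed

text \<open>
  The set \<open>A a\<close> is where the letter \<open>a\<close> pushes points. It receives \<open>D\<close> and the sets of
  all letters that do not commute with \<open>a\<close>, as well as \<open>A a\<close> itself; the one exception is the
  set of the inverse letter, where \<open>a\<close> repels. Letters of adjacent vertices do not disturb each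
  other's sets.
\<close>

locale raag_ping_pong =
  fixes \<Gamma> :: "'v pair_pre_digraph" and X D :: "'x set"
    and A :: "'v \<times> bool \<Rightarrow> 'x set" and \<phi> :: "'v \<Rightarrow> 'x \<Rightarrow> 'x"
  assumes graph: "pair_graph \<Gamma>"
    and \<phi>: "\<phi> \<in> pverts \<Gamma> \<rightarrow> Bij X"
    and D_subset: "D \<subseteq> X"
    and commute: "\<And>v w. (v, w) \<in> parcs \<Gamma> \<Longrightarrow> \<phi> v \<otimes>\<^bsub>BijGroup X\<^esub> \<phi> w = \<phi> w \<otimes>\<^bsub>BijGroup X\<^esub> \<phi> v"
    and start: "\<And>a x. fst a \<in> pverts \<Gamma> \<Longrightarrow> x \<in> D \<Longrightarrow> letter_eval (BijGroup X) \<phi> a x \<in> A a"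
    and attract: "\<And>a b x. fst a \<in> pverts \<Gamma> \<Longrightarrow> fst b \<in> pverts \<Gamma> \<Longrightarrow> (fst a, fst b) \<notin> parcs \<Gamma>
      \<Longrightarrow> b \<noteq> (fst a, \<not> snd a) \<Longrightarrow> x \<in> A b \<Longrightarrow> letter_eval (BijGroup X) \<phi> a x \<in> A a"
    and invariant: "\<And>a b x. (fst a, fst b) \<in> parcs \<Gamma> \<Longrightarrow> x \<in> A b
      \<Longrightarrow> letter_eval (BijGroup X) \<phi> a x \<in> A b"
    and avoid: "\<And>a. fst a \<in> pverts \<Gamma> \<Longrightarrow> D \<inter> A a = {}"
begin

interpretation B: group "BijGroup X" by (rule group_BijGroup)

lemma \<phi>_carrier: "\<phi> \<in> pverts \<Gamma> \<rightarrow> carrier (BijGroup X)"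
  using \<phi> by (simp add: carrier_BijGroup)

lemma word_eval_Bij: "w \<in> lists (pverts \<Gamma> \<times> UNIV) \<Longrightarrow> word_eval (BijGroup X) \<phi> w \<in> Bij X"
  using B.word_eval_closed[OF \<phi>_carrier B.subgroup_self] by (simp add: carrier_BijGroup)

lemma word_eval_Cons_apply:
  assumes "a # w \<in> lists (pverts \<Gamma> \<times> UNIV)" "x \<in> X"
  shows "word_eval (BijGroup X) \<phi> (a # w) x
    = letter_eval (BijGroup X) \<phi> a (word_eval (BijGroup X) \<phi> w x)"
proof -
  have "letter_eval (BijGroup X) \<phi> a \<in> Bij X"
    using B.letter_eval_closed[OF \<phi>_carrier B.subgroup_self, of a] assms
    by (simp add: carrier_BijGroup)
  then show ?thesis
    using assms by (simp add: mult_BijGroup_apply word_eval_Bij)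
qed

lemma respects_relations:
  assumes "(u, v) \<in> raag_relations \<Gamma>"
  shows "word_eval (BijGroup X) \<phi> u = word_eval (BijGroup X) \<phi> v"
proof -
  interpret pair_graph \<Gamma> by (rule graph)
  obtain s t where st: "(s, t) \<in> parcs \<Gamma>" "u = [(s, True), (t, True)]" "v = [(t, True), (s, True)]"
    using assms by blast
  moreover from st(1) have "\<phi> s \<in> carrier (BijGroup X)" "\<phi> t \<in> carrier (BijGroup X)"
    using \<phi>_carrier by (auto dest: in_arcsD1 in_arcsD2)
  ultimately show ?thesis
    using commute[OF st(1)] by (simp add: letter_eval_def)
qed

lemma word_eval_cong:
  "pres_eq (pverts \<Gamma>) (raag_relations \<Gamma>) u v
    \<Longrightarrow> word_eval (BijGroup X) \<phi> u = word_eval (BijGroup X) \<phi> v"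
  by (rule B.word_eval_pres_eq[OF \<phi>_carrier respects_relations])

text \<open>
  The ping-pong step, by induction on the length. If the second letter \<open>c\<close> is not adjacent to the
  first letter \<open>a\<close>, the tail of the word sends \<open>x\<close> to \<open>A c\<close>, and \<open>a\<close> maps \<open>A c\<close> into
  \<open>A a\<close>, since \<open>c\<close> cannot be the inverse of \<open>a\<close> in a geodesic word. If they are adjacent,
  the letters are swapped: the word with \<open>c\<close> dropped still begins with \<open>a\<close>, and \<open>c\<close>
  preserves \<open>A a\<close>.
\<close>

lemma geodesic_into_attractor:
  assumes "x \<in> D" "geodesic (pverts \<Gamma>) (raag_relations \<Gamma>) (a # w)"
  shows "word_eval (BijGroup X) \<phi> (a # w) x \<in> A a"
  using assms(2)
proof (induction w arbitrary: a)
  case Nil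
  then show ?case
    using assms(1) D_subset start[of a x] word_eval_Cons_apply[of a "[]" x]
    by (auto simp: geodesic_def one_BijGroup_apply)
next
  case (Cons c w)
  let ?S = "pverts \<Gamma>" and ?R = "raag_relations \<Gamma>"
  have x: "x \<in> X" using assms(1) D_subset by blast
  have lists: "a # c # w \<in> lists (?S \<times> UNIV)" using Cons.prems by (simp add: geodesic_def)
  then have w: "w \<in> lists (?S \<times> UNIV)" and verts: "fst a \<in> ?S" "fst c \<in> ?S"
    by (simp_all add: mem_Times_iff)
  have c: "word_eval (BijGroup X) \<phi> (c # w) x \<in> A c"
    using Cons.IH geodesic_tl[OF Cons.prems] by blast
  show ?case
  proof (cases "(fst a, fst c) \<in> parcs \<Gamma>")
    case True
    interpret pair_graph \<Gamma> by (rule graph)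
    have ca: "(fst c, fst a) \<in> parcs \<Gamma>"
      using True by (rule arcs_symmetric)
    have "pres_eq ?S ?R [a, c] [c, a]"
      using raag_letters_commute[OF graph True, of "snd a" "snd c"] by simp
    then have eq: "pres_eq ?S ?R (a # c # w) (c # a # w)"
      using pres_eq.append[OF _ pres_eq.refl[OF w]] by fastforce
    have "geodesic ?S ?R (c # a # w)"
      using Cons.prems lists eq unfolding geodesic_def by (auto intro: pres_eq.trans)
    then have "word_eval (BijGroup X) \<phi> (a # w) x \<in> A a"
      using Cons.IH geodesic_tl by blast
    then have "letter_eval (BijGroup X) \<phi> c (word_eval (BijGroup X) \<phi> (a # w) x) \<in> A a"
      by (rule invariant[OF ca])
    moreover have "word_eval (BijGroup X) \<phi> (c # a # w) x
        = letter_eval (BijGroup X) \<phi> c (word_eval (BijGroup X) \<phi> (a # w) x)"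
      using lists x by (intro word_eval_Cons_apply) simp_all
    ultimately show ?thesis using word_eval_cong[OF eq] by metis
  next
    case False
    have "c \<noteq> (fst a, \<not> snd a)"
    proof
      assume "c = (fst a, \<not> snd a)"
      then have "pres_eq ?S ?R [a, c] []"
        using pres_eq.cancel[of "fst a" ?S ?R "snd a"] verts by simp
      then have "pres_eq ?S ?R (a # c # w) w"
        using pres_eq.append[OF _ pres_eq.refl[OF w]] by fastforce
      then have "length (a # c # w) \<le> length w" using Cons.prems unfolding geodesic_def by blast
      then show False by simp
    qed
    then have "letter_eval (BijGroup X) \<phi> a (word_eval (BijGroup X) \<phi> (c # w) x) \<in> A a"
      using attract verts False c by blast
    then show ?thesis using word_eval_Cons_apply[OF lists x] by simp
  qed
qed

text \<open>
  Every nontrivial element is represented by a nonempty geodesic word, hence moves \<open>D\<close> into the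
  set of its first letter, which misses \<open>D\<close>.
\<close>

theorem raag_action:
  obtains \<rho> where "\<rho> \<in> hom (raag \<Gamma>) (BijGroup X)"
    and "\<And>C g. subgroup C (BijGroup X) \<Longrightarrow> \<phi> \<in> pverts \<Gamma> \<rightarrow> C \<Longrightarrow> g \<in> carrier (raag \<Gamma>) \<Longrightarrow> \<rho> g \<in> C"
    and "\<And>g x. g \<in> carrier (raag \<Gamma>) \<Longrightarrow> g \<noteq> \<one>\<^bsub>raag \<Gamma>\<^esub> \<Longrightarrow> x \<in> D \<Longrightarrow> \<rho> g x \<notin> D"
proof -
  let ?S = "pverts \<Gamma>" and ?R = "raag_relations \<Gamma>"
  obtain \<rho> where hom: "\<rho> \<in> hom (raag \<Gamma>) (BijGroup X)"
    and eval: "\<And>w. w \<in> lists (?S \<times> UNIV) \<Longrightarrow> \<rho> (pres_rel ?S ?R `` {w}) = word_eval (BijGroup X) \<phi> w"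
    using B.presented_group_hom[OF \<phi>_carrier respects_relations] unfolding raag_def by blast
  show ?thesis
  proof (rule that[OF hom])
    fix C g assume C: "subgroup C (BijGroup X)" "\<phi> \<in> ?S \<rightarrow> C" and "g \<in> carrier (raag \<Gamma>)"
    then obtain w where "w \<in> lists (?S \<times> UNIV)" "g = pres_rel ?S ?R `` {w}"
      unfolding raag_def by (elim presented_groupE)
    then show "\<rho> g \<in> C" using B.word_eval_closed[OF C(2,1)] eval by simp
  next
    fix g x assume g: "g \<in> carrier (raag \<Gamma>)" "g \<noteq> \<one>\<^bsub>raag \<Gamma>\<^esub>" and x: "x \<in> D"
    obtain w where w: "w \<in> lists (?S \<times> UNIV)" "g = pres_rel ?S ?R `` {w}"
      using g(1) unfolding raag_def by (elim presented_groupE)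
    obtain w' where w': "geodesic ?S ?R w'" "pres_eq ?S ?R w w'"
      using geodesic_exists[OF w(1)] by blast
    then have lists: "w' \<in> lists (?S \<times> UNIV)" by (simp add: geodesic_def)
    have eq: "g = pres_rel ?S ?R `` {w'}"
      using w w'(2) lists by (simp only: pres_class_eq_iff)
    show "\<rho> g x \<notin> D"
    proof (cases w')
      case Nil
      then show ?thesis using g(2) eq by (simp add: raag_def one_presented_group)
    next
      case (Cons a u)
      have "fst a \<in> ?S" using lists Cons by (simp add: mem_Times_iff)
      moreover have "\<rho> g x \<in> A a"
        using geodesic_into_attractor[OF x, of a u] w'(1) eval[OF lists] eq Cons by simp
      ultimately show ?thesis using avoid by blast
    qed
  qed
qed

end

section \<open>Brin--Thompson groups via uniform depth\<close>

abbreviation cantor :: "nat \<Rightarrow> (nat \<Rightarrow> bool word) set" where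
  "cantor n \<equiv> topspace (cantor_cube n)"

lemma cantor_eq: "cantor n = extensional {..<n}"
  by (simp add: cantor_cube_def PiE_UNIV_domain extensional_def PiE_def)

lemma cantor_eqI:
  assumes "x \<in> cantor n" "y \<in> cantor n" "\<And>i. i < n \<Longrightarrow> x i = y i"
  shows "x = y"
  using assms by (intro extensionalityI[of x "{..<n}" y]) (auto simp: cantor_eq)

lemma restrict_in_cantor [simp]: "(\<lambda>i\<in>{..<n}. f i) \<in> cantor n"
  by (simp add: cantor_eq)

lemma cube_conc_in_cantor [simp]: "cube_conc n \<alpha> x \<in> cantor n"
  by (simp add: cube_conc_def)

lemma cube_conc_apply [simp]: "i < n \<Longrightarrow> cube_conc n \<alpha> x i = \<alpha> i \<frown> x i"
  by (simp add: cube_conc_def)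

lemma cube_conc_cube_conc:
  "cube_conc n \<alpha> (cube_conc n \<beta> x) = cube_conc n (\<lambda>i. \<alpha> i @ \<beta> i) x"
  by (rule cantor_eqI[of _ n]) auto

lemma cube_conc_cong: "(\<And>i. i < n \<Longrightarrow> \<alpha> i = \<beta> i) \<Longrightarrow> cube_conc n \<alpha> x = cube_conc n \<beta> x"
  by (rule cantor_eqI[of _ n]) auto

definition cube_strip :: "nat \<Rightarrow> (nat \<Rightarrow> bool list) \<Rightarrow> (nat \<Rightarrow> bool word) \<Rightarrow> nat \<Rightarrow> bool word" where
  "cube_strip n \<alpha> x = (\<lambda>i\<in>{..<n}. suffix (length (\<alpha> i)) (x i))"

lemma cube_strip_in_cantor [simp]: "cube_strip n \<alpha> x \<in> cantor n"
  by (simp add: cube_strip_def)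

lemma cube_strip_conc [simp]: "x \<in> cantor n \<Longrightarrow> cube_strip n \<alpha> (cube_conc n \<alpha> x) = x"
  by (rule cantor_eqI[of _ n]) (auto simp: cube_strip_def)

lemma subcubeD:
  assumes "x \<in> subcube n \<alpha>" "i < n"
  shows "x i = \<alpha> i \<frown> suffix (length (\<alpha> i)) (x i)"
proof -
  obtain y where "x i = \<alpha> i \<frown> y" using assms by (auto simp: subcube_def)
  then show ?thesis by simp
qed

lemma cube_conc_strip [simp]:
  assumes "x \<in> subcube n \<alpha>"
  shows "cube_conc n \<alpha> (cube_strip n \<alpha> x) = x"
proof (rule cantor_eqI[of _ n])
  show "x \<in> cantor n" using assms by (simp add: subcube_def)
  fix i assume i: "i < n"
  then show "cube_conc n \<alpha> (cube_strip n \<alpha> x) i = x i"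
    using subcubeD[OF assms i] by (simp add: cube_strip_def)
qed simp

lemma cube_conc_in_subcube [simp]: "cube_conc n \<alpha> x \<in> subcube n \<alpha>"
  by (auto simp: subcube_def)

lemma subcube_subset: "subcube n \<alpha> \<subseteq> cantor n"
  by (auto simp: subcube_def)

lemma subcube_eq_image: "subcube n \<alpha> = cube_conc n \<alpha> ` cantor n"
proof
  show "subcube n \<alpha> \<subseteq> cube_conc n \<alpha> ` cantor n"
    by (metis (no_types) cube_conc_strip cube_strip_in_cantor image_eqI subsetI)
qed auto

lemma cube_conc_eq_iff:
  "x \<in> cantor n \<Longrightarrow> y \<in> cantor n \<Longrightarrow> cube_conc n \<alpha> x = cube_conc n \<alpha> y \<longleftrightarrow> x = y"
  by (metis cube_strip_conc)

lemma prefix_cube: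
  assumes "x \<in> cantor n"
  shows "x = cube_conc n (\<lambda>i. prefix N (x i)) (\<lambda>i\<in>{..<n}. suffix N (x i))"
  using assms by (intro cantor_eqI[of _ n]) (auto simp: prefix_suffix[symmetric])

lemma conc_eq_take:
  assumes "u \<frown> x = v \<frown> y" "length v \<le> length u"
  shows "take (length v) u = v"
proof -
  have "prefix (length v) (u \<frown> x) = take (length v) u" using assms(2) by (rule prefix_conc_fst)
  moreover have "prefix (length v) (v \<frown> y) = v" by (rule prefix_conc_length)
  ultimately show ?thesis using assms(1) by simp
qed

text \<open>
  Membership in a subcube depends on finitely many bits, and sufficiently long prefixes fix them all.
\<close>

lemma subcube_decided [consumes 1]:
  assumes "\<forall>i<n. length (\<gamma> i) \<le> length (\<alpha> i)"
  obtains (inside) \<delta> where "\<And>i. i < n \<Longrightarrow> length (\<alpha> i) = length (\<gamma> i) + length (\<delta> i)"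
      "\<And>x. cube_conc n \<alpha> x = cube_conc n \<gamma> (cube_conc n \<delta> x)"
    | (outside) "\<And>x. cube_conc n \<alpha> x \<notin> subcube n \<gamma>"
proof (cases "\<forall>i<n. take (length (\<gamma> i)) (\<alpha> i) = \<gamma> i")
  case True
  let ?\<delta> = "\<lambda>i. drop (length (\<gamma> i)) (\<alpha> i)"
  have eq: "\<alpha> i = \<gamma> i @ ?\<delta> i" if "i < n" for i
    using True that by (metis append_take_drop_id)
  then have conc: "cube_conc n \<alpha> x = cube_conc n \<gamma> (cube_conc n ?\<delta> x)" for x
    unfolding cube_conc_cube_conc by (rule cube_conc_cong)
  have len: "length (\<alpha> i) = length (\<gamma> i) + length (?\<delta> i)" if "i < n" for i
    using assms that by simp
  show ?thesis by (rule inside[of ?\<delta>, OF len conc])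
next
  case False
  then obtain i where i: "i < n" "take (length (\<gamma> i)) (\<alpha> i) \<noteq> \<gamma> i" by blast
  have "cube_conc n \<alpha> x \<notin> subcube n \<gamma>" for x
  proof
    assume "cube_conc n \<alpha> x \<in> subcube n \<gamma>"
    then obtain y where "\<alpha> i \<frown> x i = \<gamma> i \<frown> y" using i(1) by (auto simp: subcube_def)
    then show False using conc_eq_take assms i by blast
  qed
  then show ?thesis using outside by blast
qed

text \<open>
  A description of the elements of the Brin--Thompson group without partitions: on every subcube
  whose prefixes are all long enough, \<open>h\<close> is a prefix replacement. Quantifying over all
  sufficiently long prefixes, not over those of one length, lets the criterion be applied to image
  subcubes, whose prefixes have various lengths.
\<close>

definition uniformly_canonical :: "nat \<Rightarrow> ((nat \<Rightarrow> bool word) \<Rightarrow> nat \<Rightarrow> bool word) \<Rightarrow> bool" where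
  "uniformly_canonical n h \<longleftrightarrow> (\<exists>N. \<forall>\<alpha>. (\<forall>i<n. N \<le> length (\<alpha> i)) \<longrightarrow>
    (\<exists>\<beta>. \<forall>x\<in>cantor n. h (cube_conc n \<alpha> x) = cube_conc n \<beta> x))"

text \<open>
  Lengthening the prefixes of the source by \<open>L\<close> lengthens those of the target by \<open>L\<close>, so the
  image subcubes may be taken as small as desired.
\<close>

lemma uniformly_canonicalE:
  assumes "uniformly_canonical n h"
  obtains N where "\<And>\<alpha>. (\<And>i. i < n \<Longrightarrow> N \<le> length (\<alpha> i)) \<Longrightarrow>
    \<exists>\<beta>. (\<forall>i<n. L \<le> length (\<beta> i)) \<and> (\<forall>x\<in>cantor n. h (cube_conc n \<alpha> x) = cube_conc n \<beta> x)"
proof -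
  obtain N where N: "\<And>\<alpha>. \<forall>i<n. N \<le> length (\<alpha> i) \<Longrightarrow>
      \<exists>\<beta>. \<forall>x\<in>cantor n. h (cube_conc n \<alpha> x) = cube_conc n \<beta> x"
    using assms unfolding uniformly_canonical_def by blast
  have "\<exists>\<beta>. (\<forall>i<n. L \<le> length (\<beta> i)) \<and> (\<forall>x\<in>cantor n. h (cube_conc n \<alpha> x) = cube_conc n \<beta> x)"
    if long: "\<And>i. i < n \<Longrightarrow> N + L \<le> length (\<alpha> i)" for \<alpha>
  proof -
    let ?u = "\<lambda>i. take N (\<alpha> i)" and ?w = "\<lambda>i. drop N (\<alpha> i)"
    have "\<forall>i<n. N \<le> length (?u i)" using long by (auto dest: add_leD1)
    from N[OF this] obtain \<beta>
      where \<beta>: "\<And>x. x \<in> cantor n \<Longrightarrow> h (cube_conc n ?u x) = cube_conc n \<beta> x" by blast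
    have "h (cube_conc n \<alpha> x) = cube_conc n (\<lambda>i. \<beta> i @ ?w i) x" if "x \<in> cantor n" for x
      using \<beta>[of "cube_conc n ?w x"] by (simp add: cube_conc_cube_conc)
    moreover have "L \<le> length (\<beta> i @ ?w i)" if "i < n" for i
      using long[OF that] by simp
    ultimately show ?thesis by (intro exI[of _ "\<lambda>i. \<beta> i @ ?w i"]) blast
  qed
  then show ?thesis using that by blast
qed

lemma uniformly_canonical_compose:
  assumes "uniformly_canonical n g" "uniformly_canonical n h"
  shows "uniformly_canonical n (compose (cantor n) g h)"
proof -
  obtain M where M: "\<And>\<alpha>. (\<And>i. i < n \<Longrightarrow> M \<le> length (\<alpha> i)) \<Longrightarrow>
    \<exists>\<beta>. (\<forall>i<n. 0 \<le> length (\<beta> i)) \<and> (\<forall>x\<in>cantor n. g (cube_conc n \<alpha> x) = cube_conc n \<beta> x)"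
    using uniformly_canonicalE[OF assms(1), of 0] by blast
  obtain N where N: "\<And>\<alpha>. (\<And>i. i < n \<Longrightarrow> N \<le> length (\<alpha> i)) \<Longrightarrow>
    \<exists>\<beta>. (\<forall>i<n. M \<le> length (\<beta> i)) \<and> (\<forall>x\<in>cantor n. h (cube_conc n \<alpha> x) = cube_conc n \<beta> x)"
    using uniformly_canonicalE[OF assms(2), of M] by blast
  show ?thesis
    unfolding uniformly_canonical_def
  proof (intro exI[of _ N] allI impI)
    fix \<alpha> :: "nat \<Rightarrow> bool list" assume "\<forall>i<n. N \<le> length (\<alpha> i)"
    then obtain \<beta> where \<beta>: "\<forall>i<n. M \<le> length (\<beta> i)"
      "\<forall>x\<in>cantor n. h (cube_conc n \<alpha> x) = cube_conc n \<beta> x" using N[of \<alpha>] by blast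
    then obtain \<gamma> where "\<forall>x\<in>cantor n. g (cube_conc n \<beta> x) = cube_conc n \<gamma> x"
      using M[of \<beta>] by blast
    then show "\<exists>\<beta>. \<forall>x\<in>cantor n. compose (cantor n) g h (cube_conc n \<alpha> x) = cube_conc n \<beta> x"
      using \<beta>(2) by (auto simp: compose_def)
  qed
qed

lemma partition_uniformly_canonical:
  assumes part: "subcube_partition n k \<alpha>"
    and h: "\<forall>j<k. \<forall>x\<in>cantor n. h (cube_conc n (\<alpha> j) x) = cube_conc n (\<beta> j) x"
  shows "uniformly_canonical n h"
proof -
  define N where "N = Max ((\<lambda>(j, i). length (\<alpha> j i)) ` ({..<k} \<times> {..<n}))"
  have N: "length (\<alpha> j i) \<le> N" if "j < k" "i < n" for j i
    unfolding N_def using that by (intro Max_ge) (auto intro!: image_eqI[of _ _ "(j, i)"])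
  show ?thesis
    unfolding uniformly_canonical_def
  proof (intro exI[of _ N] allI impI)
    fix \<gamma> :: "nat \<Rightarrow> bool list" assume \<gamma>: "\<forall>i<n. N \<le> length (\<gamma> i)"
    have "cube_conc n \<gamma> undefined \<in> (\<Union>j<k. subcube n (\<alpha> j))"
      using part by (simp add: subcube_partition_def)
    then obtain j where j: "j < k" "cube_conc n \<gamma> undefined \<in> subcube n (\<alpha> j)" by blast
    have "\<forall>i<n. length (\<alpha> j i) \<le> length (\<gamma> i)"
      using N[OF j(1)] \<gamma> by (meson le_trans)
    then show "\<exists>\<beta>. \<forall>x\<in>cantor n. h (cube_conc n \<gamma> x) = cube_conc n \<beta> x"
    proof (cases rule: subcube_decided)
      case (inside \<delta>)
      then have "\<forall>x\<in>cantor n. h (cube_conc n \<gamma> x) = cube_conc n (\<lambda>i. \<beta> j i @ \<delta> i) x"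
        using h j(1) by (simp add: cube_conc_cube_conc[symmetric])
      then show ?thesis by blast
    next
      case outside
      then show ?thesis using j(2) by blast
    qed
  qed
qed

text \<open>
  The subcubes of a fixed depth form a partition, and their images form one because \<open>h\<close> is a
  bijection.
\<close>

lemma uniformly_canonical_partition:
  assumes h: "h \<in> Bij (cantor n)" and "uniformly_canonical n h"
  obtains k \<alpha> \<beta> where "subcube_partition n k \<alpha>" "subcube_partition n k \<beta>"
    "\<forall>j<k. \<forall>x\<in>cantor n. h (cube_conc n (\<alpha> j) x) = cube_conc n (\<beta> j) x"
proof -
  obtain N where N: "\<And>\<alpha>. \<forall>i<n. N \<le> length (\<alpha> i) \<Longrightarrow>
      \<exists>\<beta>. \<forall>x\<in>cantor n. h (cube_conc n \<alpha> x) = cube_conc n \<beta> x"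
    using assms(2) unfolding uniformly_canonical_def by blast
  let ?T = "{..<n} \<rightarrow>\<^sub>E {u :: bool list. length u = N}"
  have "finite {u :: bool list. length u = N}"
    using finite_lists_length_eq[of "UNIV :: bool set" N] by simp
  then have "finite ?T" by (intro finite_PiE) auto
  then obtain \<alpha> where \<alpha>: "bij_betw \<alpha> {..<card ?T} ?T"
    using ex_bij_betw_nat_finite by (metis lessThan_atLeast0)
  let ?k = "card ?T"
  have \<alpha>_T: "\<alpha> j \<in> ?T" if "j < ?k" for j
    using bij_betwE[OF \<alpha>] that by blast
  then have len: "length (\<alpha> j i) = N" if "j < ?k" "i < n" for j i
    using that by (auto simp: PiE_iff)
  have "\<exists>\<beta>. \<forall>x\<in>cantor n. h (cube_conc n (\<alpha> j) x) = cube_conc n \<beta> x" if "j < ?k" for j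
    using that by (intro N) (simp add: len)
  then obtain \<beta> where \<beta>: "\<And>j x. j < ?k \<Longrightarrow> x \<in> cantor n
      \<Longrightarrow> h (cube_conc n (\<alpha> j) x) = cube_conc n (\<beta> j) x"
    by metis
  have disj: "subcube n (\<alpha> j) \<inter> subcube n (\<alpha> j') = {}" if j: "j < ?k" "j' < ?k" "j \<noteq> j'" for j j'
  proof (rule ccontr)
    assume "subcube n (\<alpha> j) \<inter> subcube n (\<alpha> j') \<noteq> {}"
    then obtain x where x: "x \<in> subcube n (\<alpha> j)" "x \<in> subcube n (\<alpha> j')" by blast
    have "\<alpha> j i = \<alpha> j' i" if "i < n" for i
    proof -
      have "\<alpha> j i \<frown> suffix (length (\<alpha> j i)) (x i) = \<alpha> j' i \<frown> suffix (length (\<alpha> j' i)) (x i)"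
        by (rule HOL.trans[OF subcubeD[OF x(1) that, symmetric] subcubeD[OF x(2) that]])
      then show ?thesis using j that by (simp add: len)
    qed
    then have "\<alpha> j = \<alpha> j'"
      using \<alpha>_T[OF j(1)] \<alpha>_T[OF j(2)] by (intro PiE_ext) auto
    from inj_onD[OF bij_betw_imp_inj_on[OF \<alpha>] this] show False using j by simp
  qed
  have cover: "(\<Union>j<?k. subcube n (\<alpha> j)) = cantor n"
  proof
    show "cantor n \<subseteq> (\<Union>j<?k. subcube n (\<alpha> j))"
    proof
      fix x assume x: "x \<in> cantor n"
      let ?u = "\<lambda>i\<in>{..<n}. prefix N (x i)"
      have "?u \<in> ?T" by simp
      then obtain j where j: "j < ?k" "\<alpha> j = ?u"
        using \<alpha> unfolding bij_betw_def by (metis (no_types, lifting) imageE lessThan_iff)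
      have "x = cube_conc n (\<lambda>i. prefix N (x i)) (\<lambda>i\<in>{..<n}. suffix N (x i))"
        by (rule prefix_cube[OF x])
      also have "\<dots> = cube_conc n (\<alpha> j) (\<lambda>i\<in>{..<n}. suffix N (x i))"
        by (rule cube_conc_cong) (simp add: j(2))
      finally have "x = cube_conc n (\<alpha> j) (\<lambda>i\<in>{..<n}. suffix N (x i))" .
      then have "x \<in> subcube n (\<alpha> j)" by (metis cube_conc_in_subcube)
      then show "x \<in> (\<Union>j<?k. subcube n (\<alpha> j))" using j(1) by blast
    qed
  qed (use subcube_subset in blast)
  have image: "subcube n (\<beta> j) = h ` subcube n (\<alpha> j)" if "j < ?k" for j
    using \<beta>[OF that] by (simp add: subcube_eq_image image_image)
  have inj: "inj_on h (cantor n)" and surj: "h ` cantor n = cantor n"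
    using h by (auto simp: Bij_def bij_betw_def)
  have "subcube_partition n ?k \<alpha>"
    using disj cover by (auto simp: subcube_partition_def disjoint_family_on_def)
  moreover have "subcube_partition n ?k \<beta>"
    unfolding subcube_partition_def
  proof
    show "disjoint_family_on (\<lambda>j. subcube n (\<beta> j)) {..<?k}"
      unfolding disjoint_family_on_def
    proof (intro ballI impI)
      fix j j' assume j: "j \<in> {..<?k}" "j' \<in> {..<?k}" "j \<noteq> j'"
      then have "h ` subcube n (\<alpha> j) \<inter> h ` subcube n (\<alpha> j')
          = h ` (subcube n (\<alpha> j) \<inter> subcube n (\<alpha> j'))"
        using subcube_subset by (intro inj_on_image_Int[OF inj, symmetric])
      then show "subcube n (\<beta> j) \<inter> subcube n (\<beta> j') = {}"
        using j disj image by simp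
    qed
    have "(\<Union>j<?k. subcube n (\<beta> j)) = h ` (\<Union>j<?k. subcube n (\<alpha> j))"
      using image by (simp add: image_UN)
    then show "(\<Union>j<?k. subcube n (\<beta> j)) = cantor n" using cover surj by simp
  qed
  ultimately show ?thesis using \<beta> that by blast
qed

lemma openin_subcube: "openin (cantor_cube n) (subcube n \<alpha>)"
proof -
  let ?S = "\<lambda>u :: bool list. \<lambda>m. if m < length u then {u ! m} else UNIV"
  have cyl: "(\<exists>y. w = u \<frown> y) \<longleftrightarrow> w \<in> Pi\<^sub>E UNIV (?S u)" for w u
  proof
    assume w: "w \<in> Pi\<^sub>E UNIV (?S u)"
    have "w = u \<frown> suffix (length u) w"
    proof
      fix m
      have "w m \<in> ?S u m" using w by (rule PiE_mem) simp
      then show "w m = (u \<frown> suffix (length u) w) m"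
        by (cases "m < length u") (simp_all add: conc_def)
    qed
    then show "\<exists>y. w = u \<frown> y" by blast
  qed (auto simp: PiE_iff)
  have "subcube n \<alpha> = (\<Pi>\<^sub>E i\<in>{..<n}. Pi\<^sub>E UNIV (?S (\<alpha> i)))"
    unfolding subcube_def cantor_eq cyl by (rule Set.set_eqI) (simp only: PiE_iff[of _ "{..<n}"], blast)
  moreover have "finite {m. \<not> ?S u m = (UNIV :: bool set)}" for u
    by (rule finite_subset[of _ "{..<length u}"]) auto
  ultimately show ?thesis
    by (simp add: cantor_cube_def openin_PiE_gen)
qed

text \<open>
  When the image subcubes have prefixes longer than \<open>m\<close>, the bit at position \<open>m\<close> of a
  coordinate of \<open>h x\<close> is constant on each source subcube.
\<close>

lemma uniformly_canonical_continuous: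
  assumes h: "h \<in> Bij (cantor n)" and "uniformly_canonical n h"
  shows "continuous_map (cantor_cube n) (cantor_cube n) h"
proof -
  have coord: "continuous_map (cantor_cube n) (discrete_topology UNIV) (\<lambda>x. h x i m)"
    if i: "i < n" for i m
  proof -
    obtain N where N: "\<And>\<alpha>. (\<And>i. i < n \<Longrightarrow> N \<le> length (\<alpha> i)) \<Longrightarrow> \<exists>\<beta>. (\<forall>i<n. Suc m \<le> length (\<beta> i))
        \<and> (\<forall>x\<in>cantor n. h (cube_conc n \<alpha> x) = cube_conc n \<beta> x)"
      using uniformly_canonicalE[OF assms(2), of "Suc m"] by blast
    have "\<exists>T. openin (cantor_cube n) T \<and> x \<in> T \<and> T \<subseteq> {x \<in> cantor n. h x i m \<in> U}"
      if x: "x \<in> {x \<in> cantor n. h x i m \<in> U}" for x U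
    proof (intro exI conjI)
      let ?u = "\<lambda>i. prefix N (x i)"
      show "openin (cantor_cube n) (subcube n ?u)" by (rule openin_subcube)
      have x_eq: "x = cube_conc n ?u (\<lambda>i\<in>{..<n}. suffix N (x i))"
        using x by (intro prefix_cube) simp
      then show "x \<in> subcube n ?u" by (metis cube_conc_in_subcube)
      obtain \<beta> where \<beta>: "\<forall>i<n. Suc m \<le> length (\<beta> i)"
        "\<forall>x\<in>cantor n. h (cube_conc n ?u x) = cube_conc n \<beta> x"
        using N[of ?u] by auto
      then have const: "h (cube_conc n ?u y) i m = \<beta> i ! m" if "y \<in> cantor n" for y
        using i that by (auto simp: Suc_le_eq)
      then have "h x i m = \<beta> i ! m" using x_eq by (metis restrict_in_cantor)
      then show "subcube n ?u \<subseteq> {x \<in> cantor n. h x i m \<in> U}"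
        using x const by (auto simp: subcube_eq_image)
    qed
    then have "openin (cantor_cube n) {x \<in> cantor n. h x i m \<in> U}" for U
      by (subst openin_subopen) blast
    then show ?thesis by (simp add: continuous_map_def)
  qed
  have "h ` cantor n \<subseteq> extensional {..<n}"
    using h Bij_imp_funcset by (fastforce simp: cantor_eq)
  then show ?thesis
    by (subst (2) cantor_cube_def)
       (simp add: continuous_map_componentwise continuous_map_componentwise_UNIV coord)
qed

lemma compact_Hausdorff_cantor_cube:
  "compact_space (cantor_cube n)" "Hausdorff_space (cantor_cube n)"
  by (simp_all add: cantor_cube_def compact_space_product_topology Hausdorff_space_product_topology
      compact_space_discrete_topology)

text \<open>
  A uniformly canonical bijection is a homeomorphism, being a continuous bijection between compact
  Hausdorff spaces.
\<close>

lemma carrier_brin_thompson: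
  "h \<in> carrier (brin_thompson n) \<longleftrightarrow> h \<in> Bij (cantor n) \<and> uniformly_canonical n h"
proof
  assume "h \<in> carrier (brin_thompson n)"
  then show "h \<in> Bij (cantor n) \<and> uniformly_canonical n h"
    by (auto simp: brin_thompson_def intro: partition_uniformly_canonical)
next
  assume *: "h \<in> Bij (cantor n) \<and> uniformly_canonical n h"
  then have "homeomorphic_map (cantor_cube n) (cantor_cube n) h"
    by (intro continuous_imp_homeomorphic_map uniformly_canonical_continuous
        compact_Hausdorff_cantor_cube) (auto simp: Bij_def bij_betw_def)
  moreover obtain k \<alpha> \<beta> where "subcube_partition n k \<alpha>" "subcube_partition n k \<beta>"
    "\<forall>j<k. \<forall>x\<in>cantor n. h (cube_conc n (\<alpha> j) x) = cube_conc n (\<beta> j) x"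
    using uniformly_canonical_partition * by blast
  ultimately show "h \<in> carrier (brin_thompson n)"
    using * by (auto simp: brin_thompson_def)
qed

text \<open>
  Inverses are the one operation that is easier with partitions, where the roles of source and
  target are symmetric.
\<close>

lemma uniformly_canonical_inverse:
  assumes h: "h \<in> Bij (cantor n)" and "uniformly_canonical n h"
  shows "uniformly_canonical n (inv\<^bsub>BijGroup (cantor n)\<^esub> h)"
proof -
  obtain k \<alpha> \<beta> where "subcube_partition n k \<alpha>" and *: "subcube_partition n k \<beta>"
    "\<forall>j<k. \<forall>x\<in>cantor n. h (cube_conc n (\<alpha> j) x) = cube_conc n (\<beta> j) x"
    by (rule uniformly_canonical_partition[OF assms])
  have "inj_on h (cantor n)" using h by (simp add: Bij_def bij_betw_def)
  then have "(inv\<^bsub>BijGroup (cantor n)\<^esub> h) (cube_conc n (\<beta> j) x) = cube_conc n (\<alpha> j) x"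
    if "j < k" "x \<in> cantor n" for j x
    using *(2)[rule_format, OF that]
    by (simp add: inv_BijGroup[OF h] inv_into_f_eq)
  then show ?thesis using partition_uniformly_canonical[OF *(1)] by blast
qed

lemma subgroup_brin_thompson: "subgroup (carrier (brin_thompson n)) (BijGroup (cantor n))"
proof (rule subgroup.intro)
  interpret B: group "BijGroup (cantor n)" by (rule group_BijGroup)
  show "carrier (brin_thompson n) \<subseteq> carrier (BijGroup (cantor n))"
    by (auto simp: carrier_brin_thompson carrier_BijGroup)
  show "\<one>\<^bsub>BijGroup (cantor n)\<^esub> \<in> carrier (brin_thompson n)"
    by (auto simp: carrier_brin_thompson BijGroup_def id_Bij uniformly_canonical_def)
  fix g h assume *: "g \<in> carrier (brin_thompson n)" "h \<in> carrier (brin_thompson n)"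
  then show "g \<otimes>\<^bsub>BijGroup (cantor n)\<^esub> h \<in> carrier (brin_thompson n)"
    by (simp add: carrier_brin_thompson BijGroup_def compose_Bij uniformly_canonical_compose)
  show "inv\<^bsub>BijGroup (cantor n)\<^esub> g \<in> carrier (brin_thompson n)"
    using * B.inv_closed[of g]
    by (simp add: carrier_brin_thompson carrier_BijGroup uniformly_canonical_inverse)
qed

lemma brin_thompson_eq:
  "brin_thompson n = BijGroup (cantor n)\<lparr>carrier := carrier (brin_thompson n)\<rparr>"
  by (simp add: brin_thompson_def)

lemma group_brin_thompson: "group (brin_thompson n)"
  using subgroup.subgroup_is_group[OF subgroup_brin_thompson group_BijGroup]
  by (simp flip: brin_thompson_eq)

section \<open>Canonical maps supported in a subcube\<close>

text \<open>
  The subcube \<open>\<delta>\<close> is a copy of the whole cube; \<open>transplant\<close> lets \<open>h\<close> act on this copy and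
  fixes all other points. This is the copy of the Brin--Thompson group with support in a subcube.
\<close>

definition transplant ::
  "nat \<Rightarrow> (nat \<Rightarrow> bool list) \<Rightarrow> ((nat \<Rightarrow> bool word) \<Rightarrow> nat \<Rightarrow> bool word) \<Rightarrow> (nat \<Rightarrow> bool word) \<Rightarrow> nat \<Rightarrow> bool word"
  where "transplant n \<delta> h =
    (\<lambda>x\<in>cantor n. if x \<in> subcube n \<delta> then cube_conc n \<delta> (h (cube_strip n \<delta> x)) else x)"

lemma transplant_conc [simp]:
  "x \<in> cantor n \<Longrightarrow> transplant n \<delta> h (cube_conc n \<delta> x) = cube_conc n \<delta> (h x)"
  by (simp add: transplant_def)

lemma transplant_outside [simp]:
  "x \<in> cantor n \<Longrightarrow> x \<notin> subcube n \<delta> \<Longrightarrow> transplant n \<delta> h x = x"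
  by (simp add: transplant_def)

lemma transplant_in_cantor [simp]: "x \<in> cantor n \<Longrightarrow> transplant n \<delta> h x \<in> cantor n"
  by (simp add: transplant_def)

lemma subcube_cases:
  assumes "x \<in> cantor n"
  obtains (inside) y where "y \<in> cantor n" "x = cube_conc n \<alpha> y" | (outside) "x \<notin> subcube n \<alpha>"
  using assms by (auto simp: subcube_eq_image)

lemma transplant_transplant:
  assumes "x \<in> cantor n" "\<And>y. y \<in> cantor n \<Longrightarrow> h y \<in> cantor n"
  shows "transplant n \<delta> g (transplant n \<delta> h x) = transplant n \<delta> (compose (cantor n) g h) x"
  using assms(1)
  by (cases x rule: subcube_cases[where \<alpha> = \<delta>]) (simp_all add: assms compose_def)

lemma transplant_id:
  assumes "x \<in> cantor n" "\<And>y. y \<in> cantor n \<Longrightarrow> h y = y"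
  shows "transplant n \<delta> h x = x"
  using assms(1) by (cases x rule: subcube_cases[where \<alpha> = \<delta>]) (simp_all add: assms)

lemma transplant_Bij:
  assumes h: "h \<in> Bij (cantor n)"
  shows "transplant n \<delta> h \<in> Bij (cantor n)"
proof -
  interpret B: group "BijGroup (cantor n)" by (rule group_BijGroup)
  let ?h' = "inv\<^bsub>BijGroup (cantor n)\<^esub> h"
  have h': "?h' \<in> Bij (cantor n)" using B.inv_closed[of h] h by (simp add: carrier_BijGroup)
  have inverse: "?h' (h y) = y" "h (?h' y) = y" if "y \<in> cantor n" for y
    using h h' that B.l_inv[of h] B.r_inv[of h]
    by (metis carrier_BijGroup mult_BijGroup_apply one_BijGroup_apply)+
  show ?thesis
  proof (rule BijI[where h' = "transplant n \<delta> ?h'"])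
    show "transplant n \<delta> h \<in> extensional (cantor n)" by (simp add: transplant_def)
    fix x assume "x \<in> cantor n"
    then show "transplant n \<delta> ?h' (transplant n \<delta> h x) = x"
      "transplant n \<delta> h (transplant n \<delta> ?h' x) = x"
      using h h' by (simp_all add: transplant_transplant transplant_id Bij_apply_closed
          inverse compose_def)
  qed simp_all
qed

lemma transplant_uniformly_canonical:
  assumes h: "h \<in> Bij (cantor n)" and "uniformly_canonical n h"
  shows "uniformly_canonical n (transplant n \<delta> h)"
proof -
  obtain N where N: "\<And>\<alpha>. \<forall>i<n. N \<le> length (\<alpha> i) \<Longrightarrow>
      \<exists>\<beta>. \<forall>x\<in>cantor n. h (cube_conc n \<alpha> x) = cube_conc n \<beta> x"
    using assms(2) unfolding uniformly_canonical_def by blast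
  define M where "M = Max ((\<lambda>i. length (\<delta> i)) ` {..<n})"
  have M: "length (\<delta> i) \<le> M" if "i < n" for i
    using that unfolding M_def by (intro Max_ge) auto
  show ?thesis
    unfolding uniformly_canonical_def
  proof (intro exI[of _ "M + N"] allI impI)
    fix \<alpha> :: "nat \<Rightarrow> bool list" assume \<alpha>: "\<forall>i<n. M + N \<le> length (\<alpha> i)"
    then have "\<forall>i<n. length (\<delta> i) \<le> length (\<alpha> i)"
      using M by (meson add_leD1 le_trans)
    then show "\<exists>\<beta>. \<forall>x\<in>cantor n. transplant n \<delta> h (cube_conc n \<alpha> x) = cube_conc n \<beta> x"
    proof (cases rule: subcube_decided)
      case (inside \<epsilon>)
      have "\<forall>i<n. N \<le> length (\<epsilon> i)" using \<alpha> M inside(1) by fastforce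
      then obtain \<beta> where "\<forall>x\<in>cantor n. h (cube_conc n \<epsilon> x) = cube_conc n \<beta> x" using N by blast
      then have "\<forall>x\<in>cantor n. transplant n \<delta> h (cube_conc n \<alpha> x)
          = cube_conc n (\<lambda>i. \<delta> i @ \<beta> i) x"
        by (simp add: inside(2) cube_conc_cube_conc[symmetric])
      then show ?thesis by blast
    next
      case outside
      then show ?thesis by (intro exI[of _ \<alpha>]) simp
    qed
  qed
qed

lemma transplant_mon:
  "transplant n \<delta> \<in> mon (brin_thompson n) (BijGroup (cantor n))"
  unfolding mon_def
proof (intro CollectI conjI homI inj_onI)
  fix g h assume "g \<in> carrier (brin_thompson n)" "h \<in> carrier (brin_thompson n)"
  then have gh: "g \<in> Bij (cantor n)" "h \<in> Bij (cantor n)" by (simp_all add: carrier_brin_thompson)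
  show "transplant n \<delta> g \<in> carrier (BijGroup (cantor n))"
    using gh by (simp add: carrier_BijGroup transplant_Bij)
  have mult: "g \<otimes>\<^bsub>brin_thompson n\<^esub> h = compose (cantor n) g h"
    using gh by (simp add: brin_thompson_def BijGroup_def)
  show "transplant n \<delta> (g \<otimes>\<^bsub>brin_thompson n\<^esub> h)
      = transplant n \<delta> g \<otimes>\<^bsub>BijGroup (cantor n)\<^esub> transplant n \<delta> h"
    unfolding mult
    by (rule Bij_eqI[of _ "cantor n"])
       (use gh in \<open>simp_all add: transplant_Bij compose_Bij mult_BijGroup_closed
          mult_BijGroup_apply transplant_transplant Bij_apply_closed\<close>)
next
  fix g h assume "g \<in> carrier (brin_thompson n)" "h \<in> carrier (brin_thompson n)"
  then have gh: "g \<in> Bij (cantor n)" "h \<in> Bij (cantor n)" by (simp_all add: carrier_brin_thompson)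
  assume eq: "transplant n \<delta> g = transplant n \<delta> h"
  show "g = h"
  proof (rule Bij_eqI[OF gh])
    fix x assume x: "x \<in> cantor n"
    then have "cube_conc n \<delta> (g x) = cube_conc n \<delta> (h x)"
      using fun_cong[OF eq, of "cube_conc n \<delta> x"] by simp
    then show "g x = h x" using gh x by (simp add: cube_conc_eq_iff Bij_apply_closed)
  qed
qed

section \<open>Ping-pong maps on the Cantor cube\<close>

text \<open>
  A map with attracting subcube \<open>\<alpha>\<close> and repelling subcube \<open>\<rho>\<close>: it sends everything outside
  \<open>\<rho>\<close> into \<open>\<alpha>\<close>, and its inverse does the same with the roles exchanged. Contracting the
  complement of \<open>\<rho>\<close> into \<open>\<alpha>\<close> leaves the complement of \<open>\<alpha>\<close> and the subcube
  \<open>\<alpha> \<cdot> \<rho>\<close> uncovered. The first is covered by expanding \<open>\<rho>\<close>, the second by the corner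
  \<open>\<rho> \<cdot> \<alpha>\<close>, which is all that the expansion leaves over. The formula is symmetric enough that
  the inverse is literally the map with \<open>\<alpha>\<close> and \<open>\<rho>\<close> exchanged.
\<close>

definition pingpong_map ::
  "nat \<Rightarrow> (nat \<Rightarrow> bool list) \<Rightarrow> (nat \<Rightarrow> bool list) \<Rightarrow> (nat \<Rightarrow> bool word) \<Rightarrow> nat \<Rightarrow> bool word" where
  "pingpong_map n \<alpha> \<rho> = (\<lambda>x\<in>cantor n.
     if x \<notin> subcube n \<rho> then cube_conc n \<alpha> x
     else let y = cube_strip n \<rho> x in
       if y \<notin> subcube n \<alpha> then y else cube_conc n \<alpha> (cube_conc n \<rho> (cube_strip n \<alpha> y)))"

lemma pingpong_map_outside:
  "x \<in> cantor n \<Longrightarrow> x \<notin> subcube n \<rho> \<Longrightarrow> pingpong_map n \<alpha> \<rho> x = cube_conc n \<alpha> x"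
  by (simp add: pingpong_map_def)

lemma pingpong_map_inside:
  "y \<in> cantor n \<Longrightarrow> y \<notin> subcube n \<alpha> \<Longrightarrow> pingpong_map n \<alpha> \<rho> (cube_conc n \<rho> y) = y"
  by (simp add: pingpong_map_def)

lemma pingpong_map_corner:
  "z \<in> cantor n \<Longrightarrow> pingpong_map n \<alpha> \<rho> (cube_conc n \<rho> (cube_conc n \<alpha> z)) = cube_conc n \<alpha> (cube_conc n \<rho> z)"
  by (simp add: pingpong_map_def)

lemma pingpong_map_cases:
  assumes "x \<in> cantor n"
  obtains (outside) "x \<notin> subcube n \<rho>"
    | (inside) y where "y \<in> cantor n" "x = cube_conc n \<rho> y" "y \<notin> subcube n \<alpha>"
    | (corner) z where "z \<in> cantor n" "x = cube_conc n \<rho> (cube_conc n \<alpha> z)"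
  using assms by (metis subcube_cases)

lemma pingpong_map_in_cantor:
  assumes "x \<in> cantor n"
  shows "pingpong_map n \<alpha> \<rho> x \<in> cantor n"
  using assms by (simp add: pingpong_map_def Let_def)

lemma pingpong_map_inverse:
  assumes x: "x \<in> cantor n" and disj: "subcube n \<alpha> \<inter> subcube n \<rho> = {}"
  shows "pingpong_map n \<rho> \<alpha> (pingpong_map n \<alpha> \<rho> x) = x"
  using x
proof (cases x rule: pingpong_map_cases[where \<alpha> = \<alpha> and \<rho> = \<rho>])
  case outside
  then show ?thesis using x by (simp add: pingpong_map_outside pingpong_map_inside)
next
  case (inside y)
  then show ?thesis by (simp add: pingpong_map_outside pingpong_map_inside)
next
  case (corner z)
  then show ?thesis by (simp add: pingpong_map_corner)
qed

lemma pingpong_map_Bij: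
  assumes "subcube n \<alpha> \<inter> subcube n \<rho> = {}"
  shows "pingpong_map n \<alpha> \<rho> \<in> Bij (cantor n)"
proof (rule BijI[where h' = "pingpong_map n \<rho> \<alpha>"])
  have "subcube n \<rho> \<inter> subcube n \<alpha> = {}" using assms by blast
  then show "\<And>x. x \<in> cantor n \<Longrightarrow> pingpong_map n \<alpha> \<rho> (pingpong_map n \<rho> \<alpha> x) = x"
    by (rule pingpong_map_inverse[rotated])
qed (use assms in \<open>simp_all add: pingpong_map_in_cantor pingpong_map_inverse
    pingpong_map_def[THEN arg_cong[where f = "\<lambda>h. h \<in> _"]]\<close>)

lemma inv_pingpong_map:
  assumes "subcube n \<alpha> \<inter> subcube n \<rho> = {}"
  shows "inv\<^bsub>BijGroup (cantor n)\<^esub> pingpong_map n \<alpha> \<rho> = pingpong_map n \<rho> \<alpha>"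
proof (rule group.inv_equality[OF group_BijGroup])
  have disj: "subcube n \<rho> \<inter> subcube n \<alpha> = {}" using assms by blast
  note Bij = pingpong_map_Bij[OF assms] pingpong_map_Bij[OF disj]
  have "compose (cantor n) (pingpong_map n \<rho> \<alpha>) (pingpong_map n \<alpha> \<rho>) = (\<lambda>x\<in>cantor n. x)"
    using pingpong_map_inverse[OF _ assms] by (auto simp: compose_def)
  then show "pingpong_map n \<rho> \<alpha> \<otimes>\<^bsub>BijGroup (cantor n)\<^esub> pingpong_map n \<alpha> \<rho>
      = \<one>\<^bsub>BijGroup (cantor n)\<^esub>"
    using Bij by (simp add: BijGroup_def)
  show "pingpong_map n \<alpha> \<rho> \<in> carrier (BijGroup (cantor n))"
    "pingpong_map n \<rho> \<alpha> \<in> carrier (BijGroup (cantor n))"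
    using Bij by (simp_all add: carrier_BijGroup)
qed

lemma pingpong_map_uniformly_canonical: "uniformly_canonical n (pingpong_map n \<alpha> \<rho>)"
proof -
  define M where "M = Max ((\<lambda>i. length (\<alpha> i) + length (\<rho> i)) ` {..<n})"
  have M: "length (\<alpha> i) + length (\<rho> i) \<le> M" if "i < n" for i
    using that unfolding M_def by (intro Max_ge) auto
  show ?thesis
    unfolding uniformly_canonical_def
  proof (intro exI[of _ M] allI impI)
    fix \<gamma> :: "nat \<Rightarrow> bool list" assume "\<forall>i<n. M \<le> length (\<gamma> i)"
    then have \<gamma>: "\<forall>i<n. length (\<alpha> i) + length (\<rho> i) \<le> length (\<gamma> i)" using M by (meson le_trans)
    then have "\<forall>i<n. length (\<rho> i) \<le> length (\<gamma> i)" by (auto dest: add_leD2)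
    then show "\<exists>\<beta>. \<forall>x\<in>cantor n. pingpong_map n \<alpha> \<rho> (cube_conc n \<gamma> x) = cube_conc n \<beta> x"
    proof (cases rule: subcube_decided)
      case outside
      then have "\<forall>x\<in>cantor n. pingpong_map n \<alpha> \<rho> (cube_conc n \<gamma> x)
          = cube_conc n (\<lambda>i. \<alpha> i @ \<gamma> i) x"
        by (simp add: pingpong_map_outside cube_conc_cube_conc)
      then show ?thesis by blast
    next
      case (inside \<delta>)
      then have "\<forall>i<n. length (\<alpha> i) \<le> length (\<delta> i)" using \<gamma> by fastforce
      then show ?thesis
      proof (cases rule: subcube_decided)
        case outside
        then have "\<forall>x\<in>cantor n. pingpong_map n \<alpha> \<rho> (cube_conc n \<gamma> x) = cube_conc n \<delta> x"
          by (simp add: inside(2) pingpong_map_inside)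
        then show ?thesis by blast
      next
        case (inside \<epsilon>)
        then have "\<forall>x\<in>cantor n. pingpong_map n \<alpha> \<rho> (cube_conc n \<gamma> x)
            = cube_conc n (\<lambda>i. \<alpha> i @ (\<rho> i @ \<epsilon> i)) x"
          unfolding \<open>\<And>x. cube_conc n \<gamma> x = cube_conc n \<rho> (cube_conc n \<delta> x)\<close>
          by (simp add: pingpong_map_corner cube_conc_cube_conc[symmetric])
        then show ?thesis by blast
      qed
    qed
  qed
qed

text \<open>
  In the splitting of the cube into the coordinates in \<open>S\<close> and the others, \<open>h\<close> is the product
  of a map of the first factor with the identity.
\<close>

definition acts_on_coords :: "nat \<Rightarrow> nat set \<Rightarrow> ((nat \<Rightarrow> bool word) \<Rightarrow> nat \<Rightarrow> bool word) \<Rightarrow> bool" where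
  "acts_on_coords n S h \<longleftrightarrow>
    (\<forall>x\<in>cantor n. \<forall>i<n. i \<notin> S \<longrightarrow> h x i = x i) \<and>
    (\<forall>x\<in>cantor n. \<forall>y\<in>cantor n. (\<forall>i<n. i \<in> S \<longrightarrow> x i = y i) \<longrightarrow> (\<forall>i<n. i \<in> S \<longrightarrow> h x i = h y i))"

lemma acts_on_coords_outside:
  "acts_on_coords n S h \<Longrightarrow> x \<in> cantor n \<Longrightarrow> i < n \<Longrightarrow> i \<notin> S \<Longrightarrow> h x i = x i"
  unfolding acts_on_coords_def by blast

lemma acts_on_coords_cong:
  assumes "acts_on_coords n S h" "x \<in> cantor n" "y \<in> cantor n"
    "\<And>j. j < n \<Longrightarrow> j \<in> S \<Longrightarrow> x j = y j" "i < n" "i \<in> S"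
  shows "h x i = h y i"
  using assms unfolding acts_on_coords_def by blast

lemma disjoint_coords_commute:
  assumes g: "g \<in> Bij (cantor n)" "acts_on_coords n S g"
    and h: "h \<in> Bij (cantor n)" "acts_on_coords n T h" and disj: "S \<inter> T = {}"
  shows "g \<otimes>\<^bsub>BijGroup (cantor n)\<^esub> h = h \<otimes>\<^bsub>BijGroup (cantor n)\<^esub> g"
proof -
  have half: "g (h x) i = h (g x) i"
    if "g \<in> Bij (cantor n)" "acts_on_coords n S g" "h \<in> Bij (cantor n)" "acts_on_coords n T h"
      "S \<inter> T = {}" "x \<in> cantor n" "i < n" "i \<notin> T" for g h S T x i
  proof -
    have cl: "g x \<in> cantor n" "h x \<in> cantor n" using that by (auto intro: Bij_apply_closed)
    then have "h (g x) i = g x i"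
      using that by (intro acts_on_coords_outside[of n T]) simp_all
    moreover have "g (h x) i = g x i"
    proof (cases "i \<in> S")
      case True
      have "h x j = x j" if "j < n" "j \<in> S" for j
        using that \<open>S \<inter> T = {}\<close> \<open>acts_on_coords n T h\<close> \<open>x \<in> cantor n\<close>
        by (intro acts_on_coords_outside[of n T]) auto
      then show ?thesis
        using True cl that by (intro acts_on_coords_cong[of n S g]) simp_all
    next
      case False
      then have "g (h x) i = h x i" "g x i = x i"
        using that cl by (simp_all add: acts_on_coords_outside[of n S])
      moreover have "h x i = x i"
        using that by (simp add: acts_on_coords_outside[of n T])
      ultimately show ?thesis by simp
    qed
    ultimately show ?thesis by simp
  qed
  have "compose (cantor n) g h x = compose (cantor n) h g x" if x: "x \<in> cantor n" for x
  proof (rule cantor_eqI[of _ n])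
    show "compose (cantor n) g h x \<in> cantor n" "compose (cantor n) h g x \<in> cantor n"
      using g h x by (simp_all add: compose_def Bij_apply_closed)
    fix i assume i: "i < n"
    have "g (h x) i = h (g x) i"
    proof (cases "i \<in> T")
      case True
      then have "i \<notin> S" using disj by blast
      then show ?thesis using half[of h T g S x i] g h disj x i by (simp add: Int_commute)
    qed (use half[of g S h T x i] g h disj x i in simp)
    then show "compose (cantor n) g h x i = compose (cantor n) h g x i"
      using x by (simp add: compose_def)
  qed
  then have "compose (cantor n) g h = compose (cantor n) h g"
    by (intro Bij_eqI[of _ "cantor n"] compose_Bij g(1) h(1))
  then show ?thesis using g h by (simp add: BijGroup_def)
qed

lemma subcube_coords_cong:
  assumes "\<And>i. i < n \<Longrightarrow> i \<notin> S \<Longrightarrow> \<alpha> i = []" "x \<in> cantor n" "y \<in> cantor n"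
    "\<And>i. i < n \<Longrightarrow> i \<in> S \<Longrightarrow> x i = y i"
  shows "x \<in> subcube n \<alpha> \<longleftrightarrow> y \<in> subcube n \<alpha>"
proof -
  have "(\<exists>w. x i = \<alpha> i \<frown> w) \<longleftrightarrow> (\<exists>w. y i = \<alpha> i \<frown> w)" if "i < n" for i
    using assms that by (cases "i \<in> S") simp_all
  then show ?thesis using assms(2,3) by (simp add: subcube_def)
qed

lemma pingpong_map_acts_on_coords:
  assumes \<alpha>: "\<And>i. i < n \<Longrightarrow> i \<notin> S \<Longrightarrow> \<alpha> i = []" and \<rho>: "\<And>i. i < n \<Longrightarrow> i \<notin> S \<Longrightarrow> \<rho> i = []"
  shows "acts_on_coords n S (pingpong_map n \<alpha> \<rho>)"
  unfolding acts_on_coords_def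
proof (intro conjI ballI allI impI)
  fix x i assume "x \<in> cantor n" "i < n" "i \<notin> S"
  then show "pingpong_map n \<alpha> \<rho> x i = x i"
    using \<alpha>[of i] \<rho>[of i] by (simp add: pingpong_map_def Let_def cube_strip_def)
next
  fix x y i assume x: "x \<in> cantor n" and y: "y \<in> cantor n"
    and eq: "\<forall>i<n. i \<in> S \<longrightarrow> x i = y i" and i: "i < n" "i \<in> S"
  have strip_eq: "\<forall>i<n. i \<in> S \<longrightarrow> cube_strip n \<rho> x i = cube_strip n \<rho> y i"
    using eq by (simp add: cube_strip_def)
  have "x \<in> subcube n \<rho> \<longleftrightarrow> y \<in> subcube n \<rho>"
    "cube_strip n \<rho> x \<in> subcube n \<alpha> \<longleftrightarrow> cube_strip n \<rho> y \<in> subcube n \<alpha>"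
    by (rule subcube_coords_cong[where S = S]; use \<alpha> \<rho> x y eq strip_eq in simp)+
  then show "pingpong_map n \<alpha> \<rho> x i = pingpong_map n \<alpha> \<rho> y i"
    using x y i eq by (simp add: pingpong_map_def Let_def cube_strip_def)
qed

section \<open>Right-angled Artin groups acting on a Cantor cube\<close>

text \<open>
  There is one coordinate \<open>c (u, w)\<close> for each pair of vertices. Prefixes are put only into the
  coordinates of pairs that are not edges, so that letters of adjacent vertices share none of them.
  A diagonal pair \<open>(v, v)\<close> separates the two letters of \<open>v\<close> from each other and from
  the base subcube; a pair \<open>(u, w)\<close> with \<open>u \<noteq> w\<close> separates the letters of \<open>u\<close> from those of
  \<open>w\<close>.
\<close>

locale raag_coordinates =
  fixes \<Gamma> :: "'v pair_pre_digraph" and n :: nat and c :: "'v \<times> 'v \<Rightarrow> nat"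
  assumes graph: "pair_graph \<Gamma>"
    and c_inj: "inj_on c (pverts \<Gamma> \<times> pverts \<Gamma>)"
    and c_less: "\<And>p. p \<in> pverts \<Gamma> \<times> pverts \<Gamma> \<Longrightarrow> c p < n"
begin

definition coords :: "'v \<Rightarrow> nat set" where
  "coords v = c ` {(u, w) \<in> pverts \<Gamma> \<times> pverts \<Gamma>. (u, w) \<notin> parcs \<Gamma> \<and> (u = v \<or> w = v)}"

text \<open>
  In the coordinate \<open>c (u, w)\<close> of a pair of distinct vertices, the attractors of \<open>u\<close> begin with
  \<open>True\<close> and those of \<open>w\<close> with \<open>False\<close>. In a diagonal coordinate the first bit \<open>True\<close> tells
  an attractor from the base subcube, and the second bit is the sign of the letter.
\<close>

definition attractor :: "'v \<times> bool \<Rightarrow> nat \<Rightarrow> bool list" where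
  "attractor a i = (if i \<in> coords (fst a) then
     (let (u, w) = inv_into (pverts \<Gamma> \<times> pverts \<Gamma>) c i in
       if u = fst a then if w = fst a then [True, snd a] else [True] else [False]) else [])"

definition base_cube :: "nat \<Rightarrow> bool list" where
  "base_cube i = (if i \<in> (\<lambda>v. c (v, v)) ` pverts \<Gamma> then [False] else [])"

definition generator :: "'v \<Rightarrow> (nat \<Rightarrow> bool word) \<Rightarrow> nat \<Rightarrow> bool word" where
  "generator v = pingpong_map n (attractor (v, True)) (attractor (v, False))"

lemma c_eq_iff:
  assumes "u \<in> pverts \<Gamma>" "w \<in> pverts \<Gamma>" "u' \<in> pverts \<Gamma>" "w' \<in> pverts \<Gamma>"
  shows "c (u, w) = c (u', w') \<longleftrightarrow> u = u' \<and> w = w'"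
  using assms inj_on_eq_iff[OF c_inj, of "(u, w)" "(u', w')"] by simp

lemma no_loop: "(v, v) \<notin> parcs \<Gamma>"
proof -
  interpret pair_graph \<Gamma> by (rule graph)
  show ?thesis using pair_no_loops by force
qed

lemma arc_sym: "(v, w) \<in> parcs \<Gamma> \<Longrightarrow> (w, v) \<in> parcs \<Gamma>"
proof -
  interpret pair_graph \<Gamma> by (rule graph)
  show "(v, w) \<in> parcs \<Gamma> \<Longrightarrow> (w, v) \<in> parcs \<Gamma>" by (rule arcs_symmetric)
qed

lemma attractor_apply:
  assumes "u \<in> pverts \<Gamma>" "w \<in> pverts \<Gamma>" "(u, w) \<notin> parcs \<Gamma>" "u = fst a \<or> w = fst a"
  shows "attractor a (c (u, w))
    = (if u = fst a then if w = fst a then [True, snd a] else [True] else [False])"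
proof -
  have "c (u, w) \<in> coords (fst a)" using assms by (auto simp: coords_def)
  moreover have "inv_into (pverts \<Gamma> \<times> pverts \<Gamma>) c (c (u, w)) = (u, w)"
    using assms by (intro inv_into_f_f c_inj) simp
  ultimately show ?thesis by (simp add: attractor_def)
qed

lemma attractor_outside: "i \<notin> coords (fst a) \<Longrightarrow> attractor a i = []"
  by (simp add: attractor_def)

text \<open>
  A coordinate that is common to both vertices would have to be that of the pair of the two, and
  edges are excluded.
\<close>

lemma coords_disjoint:
  assumes "(v, w) \<in> parcs \<Gamma>"
  shows "coords v \<inter> coords w = {}"
proof -
  have False if i: "i \<in> coords v" "i \<in> coords w" for i
  proof -
    obtain p q where pq: "i = c (p, q)" "p \<in> pverts \<Gamma>" "q \<in> pverts \<Gamma>" "(p, q) \<notin> parcs \<Gamma>"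
      "p = v \<or> q = v"
      using i(1) by (auto simp: coords_def)
    obtain p' q' where pq': "i = c (p', q')" "p' \<in> pverts \<Gamma>" "q' \<in> pverts \<Gamma>" "p' = w \<or> q' = w"
      using i(2) by (auto simp: coords_def)
    have "p = p'" "q = q'"
      using c_eq_iff[OF pq(2,3) pq'(2,3)] pq(1) pq'(1) by simp_all
    then show False using pq(4,5) pq'(4) assms arc_sym no_loop by blast
  qed
  then show ?thesis by blast
qed

lemma disjoint_at:
  assumes i: "i < n" and short: "length (\<beta> i) \<le> length (\<alpha> i)"
    and ne: "take (length (\<beta> i)) (\<alpha> i) \<noteq> \<beta> i"
  shows "subcube n \<alpha> \<inter> subcube n \<beta> = {}"
proof -
  have False if "x \<in> subcube n \<alpha>" "x \<in> subcube n \<beta>" for x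
    using conc_eq_take[OF HOL.trans[OF subcubeD[OF that(1) i, symmetric] subcubeD[OF that(2) i]] short] ne
    by simp
  then show ?thesis by blast
qed

lemma attractors_disjoint:
  assumes a: "fst a \<in> pverts \<Gamma>" and b: "fst b \<in> pverts \<Gamma>"
    and "(fst a, fst b) \<notin> parcs \<Gamma>" "a \<noteq> b"
  shows "subcube n (attractor a) \<inter> subcube n (attractor b) = {}"
proof (rule disjoint_at[of "c (fst a, fst b)"])
  show "c (fst a, fst b) < n" using a b by (intro c_less) simp
  show "length (attractor b (c (fst a, fst b))) \<le> length (attractor a (c (fst a, fst b)))"
    "take (length (attractor b (c (fst a, fst b)))) (attractor a (c (fst a, fst b)))
      \<noteq> attractor b (c (fst a, fst b))"
    using assms by (auto simp: attractor_apply prod_eq_iff)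
qed

lemma base_cube_disjoint:
  assumes "fst a \<in> pverts \<Gamma>"
  shows "subcube n base_cube \<inter> subcube n (attractor a) = {}"
proof -
  have "subcube n (attractor a) \<inter> subcube n base_cube = {}"
  proof (rule disjoint_at[of "c (fst a, fst a)"])
    have "base_cube (c (fst a, fst a)) = [False]" using assms by (auto simp: base_cube_def)
    then show "length (base_cube (c (fst a, fst a))) \<le> length (attractor a (c (fst a, fst a)))"
      "take (length (base_cube (c (fst a, fst a)))) (attractor a (c (fst a, fst a)))
        \<noteq> base_cube (c (fst a, fst a))"
      using assms by (simp_all add: attractor_apply no_loop)
  qed (use assms c_less in simp)
  then show ?thesis by blast
qed

lemma inverse_letters_disjoint:
  "v \<in> pverts \<Gamma> \<Longrightarrow> b \<noteq> b' \<Longrightarrow> subcube n (attractor (v, b)) \<inter> subcube n (attractor (v, b')) = {}"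
  by (intro attractors_disjoint) (simp_all add: no_loop)

lemma generator_in_brin_thompson:
  "v \<in> pverts \<Gamma> \<Longrightarrow> generator v \<in> carrier (brin_thompson n)"
  by (simp add: generator_def carrier_brin_thompson pingpong_map_Bij inverse_letters_disjoint
      pingpong_map_uniformly_canonical)

lemma letter_eval_generator:
  assumes "fst a \<in> pverts \<Gamma>"
  shows "letter_eval (BijGroup (cantor n)) generator a
    = pingpong_map n (attractor a) (attractor (fst a, \<not> snd a))"
proof -
  obtain v b where [simp]: "a = (v, b)" by (cases a)
  show ?thesis
    using assms
    by (cases b) (simp_all add: letter_eval_def generator_def inv_pingpong_map inverse_letters_disjoint)
qed

lemma attracted:
  assumes "fst a \<in> pverts \<Gamma>" "x \<in> cantor n" "x \<notin> subcube n (attractor (fst a, \<not> snd a))"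
  shows "letter_eval (BijGroup (cantor n)) generator a x \<in> subcube n (attractor a)"
  using assms by (simp add: letter_eval_generator pingpong_map_outside)

lemma letter_acts_on_coords:
  assumes "fst a \<in> pverts \<Gamma>"
  shows "acts_on_coords n (coords (fst a)) (letter_eval (BijGroup (cantor n)) generator a)"
  unfolding letter_eval_generator[OF assms]
  by (intro pingpong_map_acts_on_coords) (simp_all add: attractor_outside)

lemma ping_pong:
  "raag_ping_pong \<Gamma> (cantor n) (subcube n base_cube) (\<lambda>a. subcube n (attractor a)) generator"
proof (rule raag_ping_pong.intro)
  show "pair_graph \<Gamma>" by (rule graph)
  show "generator \<in> pverts \<Gamma> \<rightarrow> Bij (cantor n)"
    using generator_in_brin_thompson by (auto simp: carrier_brin_thompson)
  show "subcube n base_cube \<subseteq> cantor n" by (rule subcube_subset)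
  show "subcube n base_cube \<inter> subcube n (attractor a) = {}" if "fst a \<in> pverts \<Gamma>" for a
    using that by (rule base_cube_disjoint)
next
  interpret pair_graph \<Gamma> by (rule graph)
  fix v w assume vw: "(v, w) \<in> parcs \<Gamma>"
  then have verts: "v \<in> pverts \<Gamma>" "w \<in> pverts \<Gamma>" by (auto dest: in_arcsD1 in_arcsD2)
  then have "generator v \<in> Bij (cantor n)" "generator w \<in> Bij (cantor n)"
    using generator_in_brin_thompson by (simp_all add: carrier_brin_thompson)
  moreover have "acts_on_coords n (coords v) (generator v)" "acts_on_coords n (coords w) (generator w)"
    using letter_acts_on_coords[of "(v, True)"] letter_acts_on_coords[of "(w, True)"] verts
    by (simp_all add: letter_eval_def)
  ultimately show "generator v \<otimes>\<^bsub>BijGroup (cantor n)\<^esub> generator w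
      = generator w \<otimes>\<^bsub>BijGroup (cantor n)\<^esub> generator v"
    using coords_disjoint[OF vw] by (intro disjoint_coords_commute)
next
  fix a :: "'v \<times> bool" and x assume a: "fst a \<in> pverts \<Gamma>" and x: "x \<in> subcube n base_cube"
  then have "x \<notin> subcube n (attractor (fst a, \<not> snd a))"
    using base_cube_disjoint[of "(fst a, \<not> snd a)"] by auto
  then show "letter_eval (BijGroup (cantor n)) generator a x \<in> subcube n (attractor a)"
    using a x subcube_subset by (intro attracted) auto
next
  fix a b :: "'v \<times> bool" and x assume a: "fst a \<in> pverts \<Gamma>" and b: "fst b \<in> pverts \<Gamma>"
    and ab: "(fst a, fst b) \<notin> parcs \<Gamma>" "b \<noteq> (fst a, \<not> snd a)"
    and x: "x \<in> subcube n (attractor b)"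
  have "subcube n (attractor (fst a, \<not> snd a)) \<inter> subcube n (attractor b) = {}"
    using a b ab by (intro attractors_disjoint) auto
  then show "letter_eval (BijGroup (cantor n)) generator a x \<in> subcube n (attractor a)"
    using a x subcube_subset by (intro attracted) auto
next
  interpret pair_graph \<Gamma> by (rule graph)
  fix a b :: "'v \<times> bool" and x assume ab: "(fst a, fst b) \<in> parcs \<Gamma>" and x: "x \<in> subcube n (attractor b)"
  let ?h = "letter_eval (BijGroup (cantor n)) generator a"
  have a: "fst a \<in> pverts \<Gamma>" using ab by (rule in_arcsD1)
  have x_cantor: "x \<in> cantor n" using x subcube_subset by blast
  have "?h x i = x i" if "i < n" "i \<in> coords (fst b)" for i
    using coords_disjoint[OF ab] that x_cantor
    by (intro acts_on_coords_outside[OF letter_acts_on_coords[OF a]]) auto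
  moreover have "?h x \<in> cantor n"
    using x_cantor a by (simp add: letter_eval_generator pingpong_map_in_cantor)
  ultimately have "?h x \<in> subcube n (attractor b) \<longleftrightarrow> x \<in> subcube n (attractor b)"
    using x_cantor
    by (intro subcube_coords_cong[where S = "coords (fst b)"]) (simp_all add: attractor_outside)
  then show "?h x \<in> subcube n (attractor b)" using x by simp
qed

theorem wreath_embeds_in_brin_thompson:
  "\<exists>f. f \<in> mon (restricted_wreath (brin_thompson n) (raag \<Gamma>)) (brin_thompson n)"
proof -
  interpret P: raag_ping_pong \<Gamma> "cantor n" "subcube n base_cube"
    "\<lambda>a. subcube n (attractor a)" generator
    by (rule ping_pong)
  obtain \<rho> where hom: "\<rho> \<in> hom (raag \<Gamma>) (BijGroup (cantor n))"
    and in_C: "\<And>C g. subgroup C (BijGroup (cantor n)) \<Longrightarrow> generator \<in> pverts \<Gamma> \<rightarrow> C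
      \<Longrightarrow> g \<in> carrier (raag \<Gamma>) \<Longrightarrow> \<rho> g \<in> C"
    and displaced: "\<And>g x. g \<in> carrier (raag \<Gamma>) \<Longrightarrow> g \<noteq> \<one>\<^bsub>raag \<Gamma>\<^esub> \<Longrightarrow> x \<in> subcube n base_cube
      \<Longrightarrow> \<rho> g x \<notin> subcube n base_cube"
    by (rule P.raag_action) blast
  interpret displaced_support "brin_thompson n" "raag \<Gamma>" "cantor n" "subcube n base_cube"
    "carrier (brin_thompson n)" \<rho> "transplant n base_cube"
  proof (intro displaced_support.intro displaced_support_axioms.intro)
    show "group (brin_thompson n)" by (rule group_brin_thompson)
    show "group (raag \<Gamma>)" unfolding raag_def by (rule group_presented_group)
    show "\<rho> g \<in> carrier (brin_thompson n)" if "g \<in> carrier (raag \<Gamma>)" for g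
      using that generator_in_brin_thompson by (intro in_C subgroup_brin_thompson) auto
    show "transplant n base_cube h \<in> carrier (brin_thompson n)"
      if "h \<in> carrier (brin_thompson n)" for h
      using that
      by (simp add: carrier_brin_thompson transplant_Bij transplant_uniformly_canonical)
    show "subcube n base_cube \<noteq> {}" using cube_conc_in_subcube by blast
  qed (use hom displaced subcube_subset subgroup_brin_thompson transplant_mon in auto)
  show ?thesis using wreath_embeds by (auto simp flip: brin_thompson_eq)
qed

end

theorem theorem1p2:
  fixes \<Gamma> :: "'v pair_pre_digraph"
  assumes "pair_graph \<Gamma>"
  shows "\<exists>n\<ge>1. \<exists>f. f \<in> mon (restricted_wreath (brin_thompson n) (raag \<Gamma>)) (brin_thompson n)"
proof -
  have "finite (pverts \<Gamma>)"
  proof -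
    interpret pair_graph \<Gamma> by fact
    show ?thesis by (rule pair_finite_verts)
  qed
  then have "finite (pverts \<Gamma> \<times> pverts \<Gamma>)" by simp
  from finite_imp_inj_to_nat_seg[OF this] obtain c :: "'v \<times> 'v \<Rightarrow> nat" and m
    where c: "c ` (pverts \<Gamma> \<times> pverts \<Gamma>) = {i. i < m}" "inj_on c (pverts \<Gamma> \<times> pverts \<Gamma>)"
    by (elim exE conjE)
  \<comment> \<open>The successor keeps the dimension positive for the graph without vertices.\<close>
  interpret raag_coordinates \<Gamma> "Suc m" c
  proof (rule raag_coordinates.intro)
    fix p assume "p \<in> pverts \<Gamma> \<times> pverts \<Gamma>"
    then have "c p \<in> {i. i < m}" unfolding c(1)[symmetric] by (rule imageI)
    then show "c p < Suc m" by simp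
  qed (fact assms c(2))+
  show ?thesis using wreath_embeds_in_brin_thompson by (intro exI[of _ "Suc m"]) simp
qed

end
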